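(* Let $n$ be a positive integer coprime with $6$. Then $$ \sum_{k=0}^{n-1}\frac{(q;q^2)_k^2 (q;q^2)_{2k}}{(q^2;q^2)_{2k}(q^6;q^6)_k^2}[8k+1]q^{2k^2} \equiv q^{-(n-1)/2}[n]\biggl(\frac{-3}{n}\biggr) \pmod{[n]\Phi_n(q)^2}. $$
   Context: $(a;q)_k=\prod_{j=0}^{k-1}(1-aq^j)$ for integers $k\ge0$; $[n]=[n]_q=(1-q^n)/(1-q)$; $\Phi_n(q)=\prod_{1\le j\le n,\ \gcd(j,n)=1}(q-e^{2\pi ij/n})\in\mathbb Z[q]$ is the $n$-th cyclotomic polynomial; $\bigl(\frac{-3}{n}\bigr)$ is the Jacobi--Kronecker symbol. Congruence convention: for polynomials $A_1,A_2,P\in\mathbb Z[q]$, $A_1/A_2\equiv0\pmod{P}$ means $P$ divides $A_1$ and $P$ is coprime with $A_2$; for rational functions $A,B$, $A\equiv B\pmod P$ means $A-B\equiv0\pmod P$. *)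

theory Defs
  imports
    "HOL-Computational_Algebra.Computational_Algebra"
    "HOL-Number_Theory.Number_Theory"
    "HOL-Complex_Analysis.Complex_Analysis"
begin

definition qpoch :: "'a::comm_ring_1 \<Rightarrow> 'a \<Rightarrow> nat \<Rightarrow> 'a" where
  "qpoch a q k = (\<Prod>j<k. 1 - a * q ^ j)"

text \<open>In a field, \<open>div\<close> is the field division; in \<open>\<int>[q]\<close> it is the exact quotient of polynomials.\<close>

definition qnum :: "'a::idom_divide \<Rightarrow> nat \<Rightarrow> 'a" where
  "qnum q n = (1 - q ^ n) div (1 - q)"

lemma qnum_altdef:
  assumes "q \<noteq> 1"
  shows "qnum q n = (\<Sum>i<n. q ^ i)"
proof -
  have "1 - q ^ n = (\<Sum>i<n. q ^ i) * (1 - q)"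
    by (simp add: one_diff_power_eq mult.commute)
  with assms show ?thesis
    by (simp add: qnum_def)
qed

definition cyclotomic_complex :: "nat \<Rightarrow> complex poly" where
  "cyclotomic_complex n =
     (\<Prod>j | 1 \<le> j \<and> j \<le> n \<and> gcd j n = 1. [:- exp (2 * of_real pi * \<i> * of_nat j / of_nat n), 1:])"

definition cyclotomic :: "nat \<Rightarrow> int poly" where
  "cyclotomic n = (THE p. map_poly of_int p = cyclotomic_complex n)"

text \<open>
  The definite description in \<open>cyclotomic\<close> is meaningful: such an integer polynomial exists
  and is unique.
\<close>

lemma of_int_poly_mult:
  "map_poly of_int (p * q) = map_poly of_int p * (map_poly of_int q :: 'a::comm_ring_1 poly)"
  by (rule poly_eqI) (simp add: coeff_map_poly coeff_mult)

lemma of_int_poly_add: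
  "map_poly of_int (p + q) = map_poly of_int p + (map_poly of_int q :: 'a::comm_ring_1 poly)"
  by (rule poly_eqI) (simp add: coeff_map_poly)

lemma of_int_poly_prod:
  "map_poly of_int (prod f A) = (\<Prod>x\<in>A. map_poly of_int (f x) :: 'a::comm_ring_1 poly)"
  by (induction A rule: infinite_finite_induct) (simp_all add: of_int_poly_mult)

lemma of_int_poly_eq_iff:
  "map_poly of_int p = (map_poly of_int q :: 'a::ring_char_0 poly) \<longleftrightarrow> p = q"
  by (auto simp: poly_eq_iff coeff_map_poly)

lemma degree_of_int_poly: "degree (map_poly of_int p :: complex poly) = degree p"
  by (rule degree_map_poly) auto

lemma lead_coeff_cyclotomic_complex: "lead_coeff (cyclotomic_complex n) = 1"
  by (simp add: cyclotomic_complex_def lead_coeff_prod)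

lemma prod_unity_roots:
  assumes "n > 0"
  shows "(\<Prod>k\<in>{1..n}. [:- exp (2 * of_real pi * \<i> * of_nat k / of_nat n), 1:]) =
           (Polynomial.monom 1 n - 1 :: complex poly)"
proof -
  let ?p = "Polynomial.monom 1 n - 1 :: complex poly"
  let ?e = "\<lambda>k::nat. exp (2 * of_real pi * \<i> * of_nat k / of_nat n) :: complex"
  have lc: "lead_coeff ?p = 1"
  proof -
    have "degree ?p = n"
      using assms by (intro antisym degree_le le_degree) (auto simp: coeff_1)
    with assms show ?thesis by (simp add: coeff_1)
  qed
  have sqf: "rsquarefree ?p"
    using assms
    by (auto simp: rsquarefree_roots pderiv_diff pderiv_monom poly_monom power_0_left)
  have "bij_betw (\<lambda>k. cis (2 * pi * real k / real n)) {..<n} {z. z ^ n = 1}"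
    using Complex.bij_betw_roots_unity[OF assms] by simp
  also have "(\<lambda>k. cis (2 * pi * real k / real n)) = ?e"
    by (auto simp: fun_eq_iff cis_conv_exp mult_ac)
  finally have bij: "bij_betw ?e {..<n} {z. z ^ n = 1}" .
  have "?p = (\<Prod>z | poly ?p z = 0. [:-z, 1:])"
    using complex_poly_decompose_rsquarefree[OF sqf] lc by simp
  also have "{z. poly ?p z = 0} = {z. z ^ n = 1}"
    by (auto simp: poly_monom)
  also have "(\<Prod>z | z ^ n = 1. [:-z, 1:]) = (\<Prod>k<n. [:- ?e k, 1:])"
    using bij by (rule prod.reindex_bij_betw [symmetric])
  also have "\<dots> = (\<Prod>k\<in>{1..n}. [:- ?e k, 1:])"
  proof (rule prod.reindex_bij_witness
      [of _ "\<lambda>k. if k = n then 0 else k" "\<lambda>k. if k = 0 then n else k"], goal_cases)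
    case (5 k)
    have "?e n = 1"
      using assms exp_two_pi_i by simp
    thus ?case by auto
  qed (use assms in auto)
  finally show ?thesis ..
qed

lemma prod_cyclotomic_complex:
  assumes "n > 0"
  shows "(\<Prod>d | d dvd n. cyclotomic_complex d) = Polynomial.monom 1 n - 1"
proof -
  let ?e = "\<lambda>n k::nat. exp (2 * of_real pi * \<i> * of_nat k / of_nat n) :: complex"
  have fin: "finite {d. d dvd n}"
    using assms by simp
  have fin': "finite {j. 1 \<le> j \<and> j \<le> d \<and> gcd j d = 1}" for d :: nat
    by (rule finite_subset[of _ "{..d}"]) auto
  have "(\<Prod>d | d dvd n. cyclotomic_complex d) =
          (\<Prod>(d, j)\<in>(SIGMA d:{d. d dvd n}. {j. 1 \<le> j \<and> j \<le> d \<and> gcd j d = 1}). [:- ?e d j, 1:])"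
    unfolding cyclotomic_complex_def using fin fin' by (subst prod.Sigma) auto
  also have "\<dots> = (\<Prod>k\<in>{1..n}. [:- ?e n k, 1:])"
  proof (rule prod.reindex_bij_witness
      [of _ "\<lambda>k. (n div gcd k n, k div gcd k n)" "\<lambda>(d, j). j * (n div d)"], goal_cases)
    case (1 x)
    then obtain d j m where x: "x = (d, j)" "n = d * m" "gcd j d = 1" "j \<le> d" "j \<ge> 1"
      by auto
    have "gcd (j * m) (d * m) = m"
      using x by (metis gcd_mult_distrib_nat mult.commute mult.right_neutral)
    moreover have "d > 0" "m > 0" using assms x by auto
    ultimately show ?case using x by simp
  next
    case (2 x)
    then obtain d j m where x: "x = (d, j)" "n = d * m" "gcd j d = 1" "j \<le> d" "j \<ge> 1"
      by auto
    thus ?case using assms by auto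
  next
    case (3 k)
    obtain g m l where "k = g * m" "n = g * l" "gcd (g * m) (g * l) = g"
      by (metis dvdE gcd_dvd1 gcd_dvd2)
    moreover have "g > 0" "l > 0" using assms calculation by auto
    ultimately show ?case by simp
  next
    case (4 k)
    obtain g m l where "k = g * m" "n = g * l" "gcd (g * m) (g * l) = g"
      by (metis dvdE gcd_dvd1 gcd_dvd2)
    moreover have "g > 0" "l > 0" "m > 0" using assms calculation 4 by (auto intro!: Nat.gr0I)
    moreover have "gcd m l = 1"
      using calculation gcd_mult_distrib_nat[of g m l] by simp
    ultimately show ?case using 4 by simp
  next
    case (5 x)
    then obtain d j m where x: "x = (d, j)" "n = d * m"
      by auto
    thus ?case using assms by (simp add: mult_ac)
  qed
  also have "\<dots> = Polynomial.monom 1 n - 1"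
    using assms by (rule prod_unity_roots)
  finally show ?thesis .
qed

lemma cyclotomic_complex_in_Z:
  assumes "n > 0"
  shows "\<exists>p. map_poly of_int p = cyclotomic_complex n"
  using assms
proof (induction n rule: less_induct)
  case (less n)
  define D where "D = {d. d dvd n} - {n}"
  have fin: "finite {d. d dvd n}"
    using less.prems by simp
  have "\<exists>p. map_poly of_int p = cyclotomic_complex d" if "d \<in> D" for d
    using that less.prems by (intro less.IH) (auto simp: D_def dvd_pos_nat dest: dvd_imp_le)
  then obtain f where f: "\<And>d. d \<in> D \<Longrightarrow> map_poly of_int (f d) = cyclotomic_complex d"
    by metis
  define Q where "Q = prod f D"
  define X where "X = (Polynomial.monom 1 n - 1 :: int poly)"
  have Q: "map_poly of_int Q = (\<Prod>d\<in>D. cyclotomic_complex d)"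
    unfolding Q_def of_int_poly_prod by (intro prod.cong f refl)
  have X: "map_poly of_int X = (Polynomial.monom 1 n - 1 :: complex poly)"
    by (rule poly_eqI) (simp add: X_def coeff_map_poly coeff_1)
  have eq: "cyclotomic_complex n * map_poly of_int Q = map_poly of_int X"
    unfolding Q X D_def prod_cyclotomic_complex[OF less.prems, symmetric]
    using fin by (intro prod.remove [symmetric]) auto
  have "lead_coeff (map_poly of_int Q :: complex poly) = 1"
    unfolding Q by (simp add: lead_coeff_prod lead_coeff_cyclotomic_complex)
  hence lcQ: "lead_coeff Q = 1"
    unfolding degree_of_int_poly by (simp add: coeff_map_poly)
  hence [simp]: "Q \<noteq> 0" by auto
  obtain q r where qr: "pseudo_divmod X Q = (q, r)"
    by force
  have "X = Q * q + r" and r: "r = 0 \<or> degree r < degree Q"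
    using pseudo_divmod[OF _ qr] lcQ by simp_all
  hence "cyclotomic_complex n * map_poly of_int Q =
           map_poly of_int Q * map_poly of_int q + map_poly of_int r"
    using eq by (simp add: of_int_poly_add of_int_poly_mult)
  hence r_eq: "map_poly of_int r = map_poly of_int Q * (cyclotomic_complex n - map_poly of_int q)"
    by (simp add: algebra_simps)
  have "cyclotomic_complex n = map_poly of_int q"
  proof (rule ccontr)
    assume neq: "cyclotomic_complex n \<noteq> map_poly of_int q"
    have Q0: "map_poly of_int Q \<noteq> (0 :: complex poly)"
      using of_int_poly_eq_iff[of Q 0, where 'a = complex] by simp
    have "map_poly of_int r \<noteq> (0 :: complex poly)"
      unfolding r_eq using neq Q0 by simp
    hence "degree r < degree Q" using r by auto
    moreover have "degree (map_poly of_int r :: complex poly) \<ge> degree (map_poly of_int Q :: complex poly)"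
      unfolding r_eq using neq Q0 by (subst degree_mult_eq) auto
    ultimately show False by (simp add: degree_of_int_poly)
  qed
  thus ?case by metis
qed

lemma of_int_poly_cyclotomic:
  assumes "n > 0"
  shows "map_poly of_int (cyclotomic n) = cyclotomic_complex n"
proof -
  have "\<exists>!p. map_poly of_int p = cyclotomic_complex n"
    using cyclotomic_complex_in_Z[OF assms] by (metis of_int_poly_eq_iff)
  thus ?thesis
    unfolding cyclotomic_def by (rule theI')
qed

text \<open>
  The Jacobi--Kronecker symbol for a positive lower argument. The prime 2 needs
  its own clause, since \<open>Legendre a 2\<close> is 1 for every odd \<open>a\<close>.
\<close>

definition kronecker_prime :: "int \<Rightarrow> nat \<Rightarrow> int" where
  "kronecker_prime a p =
     (if p = 2 then (if even a then 0 else if a mod 8 \<in> {1, 7} then 1 else -1)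
      else Legendre a (int p))"

definition kronecker :: "int \<Rightarrow> nat \<Rightarrow> int" where
  "kronecker a n = (\<Prod>p\<in>#prime_factorization n. kronecker_prime a p)"

text \<open>
  Rational functions in \<open>q\<close> are fractions of integer polynomials. A rational function is congruent
  to 0 modulo \<open>P\<close> if some representation \<open>A\<^sub>1/A\<^sub>2\<close> of it has \<open>P\<close> dividing
  \<open>A\<^sub>1\<close> and \<open>P\<close> coprime with \<open>A\<^sub>2\<close>; since \<open>\<int>[q]\<close> is factorial, the
  representation in lowest terms then has this property, too.
\<close>

definition ratfun_cong_0 :: "int poly fract \<Rightarrow> int poly \<Rightarrow> bool" where
  "ratfun_cong_0 R P \<longleftrightarrow>
     (\<exists>A1 A2. A2 \<noteq> 0 \<and> R = Fract A1 A2 \<and> P dvd A1 \<and> coprime P A2)"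

definition ratfun_cong :: "int poly fract \<Rightarrow> int poly fract \<Rightarrow> int poly \<Rightarrow> bool" where
  "ratfun_cong A B P \<longleftrightarrow> ratfun_cong_0 (A - B) P"

definition qX :: "int poly" where
  "qX = [:0, 1:]"

definition qvar :: "int poly fract" where
  "qvar = to_fract qX"

end

theory Submission
  imports Defs
begin

text \<open>
  Deform the sum by a parameter \<open>a\<close>, replacing \<open>(q;q\<^sup>2)\<^sub>k\<^sup>2 / (q\<^sup>6;q\<^sup>6)\<^sub>k\<^sup>2\<close> by
  \<open>(aq,q/a;q\<^sup>2)\<^sub>k / (aq\<^sup>6,q\<^sup>6/a;q\<^sup>6)\<^sub>k\<close>. The deformed sum is an instance of the cubic sum with summand
  \<open>(1 - xq\<^sup>4\<^sup>k) (a,q/a;q)\<^sub>k (x;q)\<^sub>2\<^sub>k q^(k^2) / ((xq\<^sup>3/a,xaq\<^sup>2;q\<^sup>3)\<^sub>k (q;q)\<^sub>2\<^sub>k)\<close>, which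
  satisfies first-order recurrences under \<open>a \<mapsto> aq\<^sup>3\<close> and under \<open>x \<mapsto> xq\<^sup>3\<close>, both proved by telescoping.
  The first recurrence evaluates the deformed sum at \<open>a = q\<^sup>n\<close> as the claimed right-hand side.
  The second one shows that at a primitive \<open>d\<close>-th root of unity the sum over one period vanishes
  for every \<open>a\<close>: since \<open>x = \<zeta>\<close> is a power of \<open>\<zeta>\<^sup>-\<^sup>2\<close>, the sum splits into two sums that terminate
  because of \<open>x\<close>, the second of which is a copy of the first with \<open>k\<close> shifted by one half.

  The deformed sum depends on \<open>a\<close> only through \<open>y = (1-a)\<^sup>2/a\<close>, and after clearing denominators
  the difference of both sides is a polynomial in \<open>y\<close>. All its coefficients are divisible by \<open>\<Phi>\<^sub>n\<close>,
  and it vanishes at \<open>y = (1-q\<^sup>n)\<^sup>2/q\<^sup>n\<close>, a multiple of \<open>\<Phi>\<^sub>n\<^sup>2\<close>; hence its constant coefficient,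
  the case \<open>a = 1\<close>, is divisible by \<open>\<Phi>\<^sub>n\<^sup>3\<close>. For the other divisors \<open>d\<close> of \<open>n\<close>, the sum
  at a primitive \<open>d\<close>-th root of unity is a multiple of the vanishing sum over one period.
  Divisibility is tested locally, in the Laurent series in \<open>q - \<zeta>\<close>.
\<close>

subsection \<open>The cubic sum and its recurrence in x\<close>

lemma qpoch_0 [simp]: "qpoch a q 0 = 1"
  by (simp add: qpoch_def)

lemma qpoch_Suc: "qpoch a q (Suc k) = qpoch a q k * (1 - a * q ^ k)"
  by (simp add: qpoch_def)

lemma qpoch_add: "qpoch a q (k + l) = qpoch a q k * qpoch (a * q ^ k) q l"
  by (induction l) (simp_all add: qpoch_Suc power_add mult_ac)

lemma qpoch_shift: "(1 - a) * qpoch (a * q) q k = qpoch a q k * (1 - a * q ^ k)"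
  using qpoch_add[of a q 1 k] qpoch_Suc[of a q k] by (simp add: qpoch_Suc)

lemma qpoch_shift3:
  "(1 - a) * (1 - a * q) * (1 - a * q\<^sup>2) * qpoch (a * q ^ 3) q k =
   qpoch a q k * (1 - a * q ^ k) * (1 - a * q * q ^ k) * (1 - a * q\<^sup>2 * q ^ k)"
  using qpoch_add[of a q 3 k] qpoch_add[of a q k 3]
  by (simp add: qpoch_Suc eval_nat_numeral mult_ac add.commute)

lemma qpoch_eq_0_iff:
  fixes a q :: "'a::idom"
  shows "qpoch a q k = 0 \<longleftrightarrow> (\<exists>j<k. a * q ^ j = 1)"
  by (auto simp: qpoch_def)

lemma qpoch_eq_0_mono:
  fixes a q :: "'a::idom"
  shows "qpoch a q k = 0 \<Longrightarrow> k \<le> l \<Longrightarrow> qpoch a q l = 0"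
  by (auto simp: qpoch_eq_0_iff) (use order_less_le_trans in blast)


text \<open>
  The case \<open>e = 1\<close> is the cubic summand with \<open>k\<close> shifted by one half. The denominator has its own
  parameters \<open>C\<close>, \<open>D\<close> because the recurrence in \<open>a\<close> needs a weight common to two different summands.
\<close>

definition cubic_weight :: "nat \<Rightarrow> 'a::field \<Rightarrow> 'a \<Rightarrow> 'a \<Rightarrow> 'a \<Rightarrow> 'a \<Rightarrow> 'a \<Rightarrow> nat \<Rightarrow> 'a" where
  "cubic_weight e A B C D x q k =
     qpoch A q k * qpoch B q k * qpoch x q (2 * k + e) * q ^ (k\<^sup>2 + e * k)
     / (qpoch (x * q ^ (2 + e) * C) (q ^ 3) k * qpoch (x * q ^ (2 + e) * D) (q ^ 3) k
        * qpoch q q (2 * k + e))"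

definition cubic_term :: "nat \<Rightarrow> 'a::field \<Rightarrow> 'a \<Rightarrow> 'a \<Rightarrow> 'a \<Rightarrow> nat \<Rightarrow> 'a" where
  "cubic_term e A B x q k = (1 - x * (q ^ (2 * k + e))\<^sup>2) * cubic_weight e A B A B x q k"

text \<open>With \<open>u = q ^ (2 * k + e)\<close>, the newest factor of a base-\<open>q^3\<close>
  symbol becomes a polynomial in \<open>x\<close>, \<open>q\<close>, \<open>u\<close> and
  \<open>C q^k\<close>. No other trace of \<open>k\<close> remains, so telescoping reduces to
  polynomial identities.\<close>

lemma qpoch_cube_factor:
  "x * q ^ (2 + e) * C * (q ^ 3) ^ k = x * q\<^sup>2 * q ^ (2 * k + e) * (C * q ^ k)"
  for x :: "'a::field"
  by (simp add: power_add power_mult [symmetric] mult_ac)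
    (simp add: power_add mult_ac power_mult power3_eq_cube power2_eq_square power_mult_distrib)

text \<open>Each of the six q-Pochhammer symbols gains one or two factors, and the exponent of
  \<open>q\<close> grows by \<open>2 * k + e + 1\<close>, whence \<open>q * u\<close>.\<close>

lemma cubic_weight_Suc:
  fixes q :: "'a::field"
  assumes "qpoch q q (2 * Suc k + e) \<noteq> 0"
    and "qpoch (x * q ^ (2 + e) * C) (q ^ 3) (Suc k) \<noteq> 0"
    and "qpoch (x * q ^ (2 + e) * D) (q ^ 3) (Suc k) \<noteq> 0"
  defines "u \<equiv> q ^ (2 * k + e)"
  shows "cubic_weight e A B C D x q (Suc k) * ((1 - x * q\<^sup>2 * u * (C * q ^ k))
            * (1 - x * q\<^sup>2 * u * (D * q ^ k)) * (1 - q * u) * (1 - q\<^sup>2 * u)) =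
         cubic_weight e A B C D x q k * ((1 - A * q ^ k) * (1 - B * q ^ k) * (1 - x * u)
            * (1 - x * q * u) * (q * u))"
proof -
  have "(Suc k)\<^sup>2 + e * Suc k = (k\<^sup>2 + e * k) + Suc (2 * k + e)"
    by (simp add: power2_eq_square algebra_simps)
  hence pow: "q ^ ((Suc k)\<^sup>2 + e * Suc k) = q ^ (k\<^sup>2 + e * k) * (q * u)"
    by (simp only: power_add u_def power_Suc)
  have px: "qpoch x q (2 * Suc k + e) = qpoch x q (2 * k + e) * ((1 - x * u) * (1 - x * q * u))"
    by (simp add: qpoch_Suc u_def mult_ac)
  have pq: "qpoch q q (2 * Suc k + e) = qpoch q q (2 * k + e) * ((1 - q * u) * (1 - q\<^sup>2 * u))"
    by (simp add: qpoch_Suc u_def mult_ac power2_eq_square)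
  have pC: "qpoch (x * q ^ (2 + e) * E) (q ^ 3) (Suc k) =
      qpoch (x * q ^ (2 + e) * E) (q ^ 3) k * (1 - x * q\<^sup>2 * u * (E * q ^ k))" for E
    unfolding qpoch_Suc qpoch_cube_factor u_def by simp
  from assms(1-3) show ?thesis
    unfolding cubic_weight_def pow px pq pC qpoch_Suc[of A] qpoch_Suc[of B]
    by (simp add: divide_simps)
qed

text \<open>The last summand gets its own hypothesis because \<open>G (Suc K)\<close> may involve a
  division by zero: at the roots of unity below, \<open>qpoch q q\<close> vanishes just beyond the
  range of summation. \<open>F K = - G K\<close> replaces \<open>G (Suc K) = 0\<close>.\<close>

lemma sum_telescope_last:
  fixes F G :: "nat \<Rightarrow> 'a::ab_group_add"
  assumes "\<And>k. k < K \<Longrightarrow> F k = G (Suc k) - G k" and "F K = - G K" and "G 0 = 0"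
  shows "(\<Sum>k\<le>K. F k) = 0"
proof -
  have "(\<Sum>k\<le>K. F k) = (\<Sum>k<K. G (Suc k) - G k) + F K"
    using assms(1) by (simp add: lessThan_Suc_atMost [symmetric])
  thus ?thesis
    using assms(2,3) by (simp only: sum_lessThan_telescope) simp
qed

text \<open>Passing from \<open>x\<close> to \<open>x * q ^ 3\<close> moves the
  base-\<open>q\<close> symbol in \<open>x\<close> by three factors but the base-\<open>q^3\<close>
  symbols by only one. Hence the shifted summand is a rational multiple of the unshifted
  weight.\<close>

lemma cubic_term_shift_x:
  fixes q :: "'a::field"
  assumes "qpoch (x * q ^ (2 + e) * A) (q ^ 3) (Suc k) \<noteq> 0"
    and "qpoch (x * q ^ (2 + e) * B) (q ^ 3) (Suc k) \<noteq> 0"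
  defines "u \<equiv> q ^ (2 * k + e)"
  shows "cubic_term e A B (x * q ^ 3) q k * ((1 - x) * (1 - x * q) * (1 - x * q\<^sup>2))
           * ((1 - x * q\<^sup>2 * u * (A * q ^ k)) * (1 - x * q\<^sup>2 * u * (B * q ^ k))) =
         cubic_weight e A B A B x q k * ((1 - x * q ^ 3 * u\<^sup>2) * (1 - x * u) * (1 - x * q * u)
           * (1 - x * q\<^sup>2 * u)) * ((1 - x * q ^ (2 + e) * A) * (1 - x * q ^ (2 + e) * B))"
proof -
  have px: "(1 - x) * (1 - x * q) * (1 - x * q\<^sup>2) * qpoch (x * q ^ 3) q (2 * k + e) =
      qpoch x q (2 * k + e) * (1 - x * u) * (1 - x * q * u) * (1 - x * q\<^sup>2 * u)"
    unfolding u_def by (rule qpoch_shift3)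
  have pC: "(1 - x * q ^ (2 + e) * E) * qpoch (x * q ^ 3 * q ^ (2 + e) * E) (q ^ 3) k =
      qpoch (x * q ^ (2 + e) * E) (q ^ 3) k * (1 - x * q\<^sup>2 * u * (E * q ^ k))" for E
    using qpoch_shift[of "x * q ^ (2 + e) * E" "q ^ 3" k]
    unfolding qpoch_cube_factor u_def [symmetric] by (simp add: mult_ac)
  define a where "a = qpoch (x * q ^ 3 * q ^ (2 + e) * A) (q ^ 3) k"
  define b where "b = qpoch (x * q ^ 3 * q ^ (2 + e) * B) (q ^ 3) k"
  define a' where "a' = qpoch (x * q ^ (2 + e) * A) (q ^ 3) k"
  define b' where "b' = qpoch (x * q ^ (2 + e) * B) (q ^ 3) k"
  define la where "la = 1 - x * q ^ (2 + e) * A"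
  define lb where "lb = 1 - x * q ^ (2 + e) * B"
  define ra where "ra = 1 - x * q\<^sup>2 * u * (A * q ^ k)"
  define rb where "rb = 1 - x * q\<^sup>2 * u * (B * q ^ k)"
  have "a' * ra \<noteq> 0" "b' * rb \<noteq> 0"
    using assms(1,2) unfolding a'_def b'_def ra_def rb_def qpoch_Suc qpoch_cube_factor u_def by auto
  moreover have ea: "la * a = a' * ra" and eb: "lb * b = b' * rb"
    unfolding a_def b_def a'_def b'_def la_def lb_def ra_def rb_def by (rule pC)+
  ultimately have nz: "a \<noteq> 0" "b \<noteq> 0" "a' \<noteq> 0" "b' \<noteq> 0" "ra \<noteq> 0" "rb \<noteq> 0" "la \<noteq> 0" "lb \<noteq> 0"
    by auto
  have "cubic_term e A B (x * q ^ 3) q k * ((1 - x) * (1 - x * q) * (1 - x * q\<^sup>2)) * (ra * rb) =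
     (1 - x * q ^ 3 * u\<^sup>2) * qpoch A q k * qpoch B q k * q ^ (k\<^sup>2 + e * k) / qpoch q q (2 * k + e)
     * ((1 - x) * (1 - x * q) * (1 - x * q\<^sup>2) * qpoch (x * q ^ 3) q (2 * k + e)) * (ra / a * (rb / b))"
    unfolding cubic_term_def cubic_weight_def a_def [symmetric] b_def [symmetric] u_def [symmetric]
    by (simp add: mult_ac)
  also have "ra / a = la / a'" using ea nz by (simp add: divide_simps)
  also have "rb / b = lb / b'" using eb nz by (simp add: divide_simps)
  finally show ?thesis
    unfolding px cubic_weight_def
    unfolding a'_def [symmetric] b'_def [symmetric] ra_def [symmetric] rb_def [symmetric]
      la_def [symmetric] lb_def [symmetric] by (simp add: mult_ac)
qed

text \<open>
  The telescoping identity with \<open>u = q^(2k+e)\<close>, \<open>\<alpha> = Aq\<^sup>k\<close>, \<open>\<beta> = Bq\<^sup>k\<close>; the certificate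
  \<open>- x (1-u) (q-u)\<close> was found by interpolating partial sums.
\<close>

lemma cubic_term_x_certificate:
  fixes q :: "'a::field"
  assumes "\<alpha> * \<beta> = q * u"
  shows "(1 - x * q ^ 3 * u\<^sup>2) * (1 - x * u) * (1 - x * q * u) * (1 - x * q\<^sup>2 * u)
       - (1 - x * q) * (1 - x * u\<^sup>2) * (1 - x * q\<^sup>2 * u * \<beta>) * (1 - x * q\<^sup>2 * u * \<alpha>) =
     - (x * q\<^sup>2 * u * (1 - \<alpha>) * (1 - \<beta>) * (1 - x * u) * (1 - x * q * u))
       + x * (1 - u) * (q - u) * (1 - x * q\<^sup>2 * u * \<beta>) * (1 - x * q\<^sup>2 * u * \<alpha>)"
proof -
  \<comment> \<open>\<open>\<alpha>\<close> and \<open>\<beta>\<close> enter only through their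
    product, fixed by the assumption, and their sum, which becomes the free variable
    \<open>s\<close> below.\<close>
  have 1: "(1 - x * q\<^sup>2 * u * \<beta>) * (1 - x * q\<^sup>2 * u * \<alpha>) =
      1 - x * q\<^sup>2 * u * (\<alpha> + \<beta>) + x\<^sup>2 * q ^ 4 * u\<^sup>2 * (\<alpha> * \<beta>)"
    by (simp add: algebra_simps eval_nat_numeral)
  have 2: "(1 - \<alpha>) * (1 - \<beta>) = 1 - (\<alpha> + \<beta>) + \<alpha> * \<beta>"
    by (simp add: algebra_simps eval_nat_numeral)
  have "(1 - x * q ^ 3 * u\<^sup>2) * (1 - x * u) * (1 - x * q * u) * (1 - x * q\<^sup>2 * u)
       - (1 - x * q) * (1 - x * u\<^sup>2) * (1 - x * q\<^sup>2 * u * s + x\<^sup>2 * q ^ 4 * u\<^sup>2 * (q * u)) =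
     - (x * q\<^sup>2 * u * (1 - s + q * u) * (1 - x * u) * (1 - x * q * u))
       + x * (1 - u) * (q - u) * (1 - x * q\<^sup>2 * u * s + x\<^sup>2 * q ^ 4 * u\<^sup>2 * (q * u))" for s
    by (simp add: algebra_simps eval_nat_numeral)
  thus ?thesis
    using 1 2 unfolding assms by (simp add: mult.assoc)
qed

text \<open>Telescoping shows that \<open>c\<close> times the sum at \<open>x q^3\<close> equals
  \<open>1 - x q\<close> times the sum at \<open>x\<close>, so vanishing passes from
  \<open>x q^3\<close> to \<open>x\<close>. The upper boundary term disappears because
  \<open>qpoch x q (2 * Suc K + e)\<close> is zero.\<close>

lemma cubic_term_x_step:
  fixes q :: "'a::field"
  assumes AB: "A * B = q ^ Suc e" and e: "e \<le> 1"
    and nzA: "qpoch (x * q ^ (2 + e) * A) (q ^ 3) (Suc K) \<noteq> 0"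
    and nzB: "qpoch (x * q ^ (2 + e) * B) (q ^ 3) (Suc K) \<noteq> 0"
    and nzq: "qpoch q q (2 * K + e) \<noteq> 0"
    and x: "qpoch x q (2 * Suc K + e) = 0" "x * q \<noteq> 1"
    and S: "(\<Sum>k\<le>K. cubic_term e A B (x * q ^ 3) q k) = 0"
  shows "(\<Sum>k\<le>K. cubic_term e A B x q k) = 0"
proof -
  define U where "U = (\<lambda>k. q ^ (2 * k + e))"
  define V where "V = cubic_weight e A B A B x q"
  define G where "G = (\<lambda>k. - x * (1 - U k) * (q - U k) * V k)"
  define c where "c = (1 - x) * (1 - x * q) * (1 - x * q\<^sup>2) /
      ((1 - x * q ^ (2 + e) * A) * (1 - x * q ^ (2 + e) * B))"
  define F where "F = (\<lambda>k. c * cubic_term e A B (x * q ^ 3) q k - (1 - x * q) * cubic_term e A B x q k)"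
  define R where "R = (\<lambda>k. (1 - x * q\<^sup>2 * U k * (A * q ^ k)) * (1 - x * q\<^sup>2 * U k * (B * q ^ k)))"
  define N where "N = (\<lambda>k. (1 - A * q ^ k) * (1 - B * q ^ k) * (1 - x * U k) * (1 - x * q * U k))"
  have nz: "qpoch (x * q ^ (2 + e) * A) (q ^ 3) (Suc k) \<noteq> 0"
    "qpoch (x * q ^ (2 + e) * B) (q ^ 3) (Suc k) \<noteq> 0" "qpoch q q (2 * k + e) \<noteq> 0"
    if "k \<le> K" for k
    using nzA nzB nzq that qpoch_eq_0_mono[of _ _ "Suc k" "Suc K"]
      qpoch_eq_0_mono[of q q "2 * k + e" "2 * K + e"] by auto
  have nz0: "1 - x * q ^ (2 + e) * A \<noteq> 0" "1 - x * q ^ (2 + e) * B \<noteq> 0"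
    using nz[of 0] by (simp_all add: qpoch_Suc)
  have nzR: "R k \<noteq> 0" if "k \<le> K" for k
    using nz[OF that] unfolding R_def U_def qpoch_Suc qpoch_cube_factor by auto
  \<comment> \<open>The first term is what \<open>G (Suc k) * R k\<close> turns out to be for
    \<open>k < K\<close>; in this form it makes sense for \<open>k = K\<close> too, without
    \<open>V (Suc K)\<close>.\<close>
  have FR: "F k * R k = - x * q\<^sup>2 * U k * V k * N k - G k * R k" if "k \<le> K" for k
  proof -
    have "F k * R k = V k * ((1 - x * q ^ 3 * (U k)\<^sup>2) * (1 - x * U k) * (1 - x * q * U k)
           * (1 - x * q\<^sup>2 * U k) - (1 - x * q) * (1 - x * (U k)\<^sup>2) * R k)"
    proof -
      have "c * cubic_term e A B (x * q ^ 3) q k * R k = V k * ((1 - x * q ^ 3 * (U k)\<^sup>2)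
           * (1 - x * U k) * (1 - x * q * U k) * (1 - x * q\<^sup>2 * U k))"
        using cubic_term_shift_x[of x q e A k B] nz[OF that] nz0
        unfolding c_def R_def V_def U_def
        by (simp add: nonzero_divide_eq_eq mult_ac)
      moreover have "cubic_term e A B x q k = (1 - x * (U k)\<^sup>2) * V k"
        by (simp add: cubic_term_def U_def V_def)
      ultimately show ?thesis
        by (simp add: F_def left_diff_distrib right_diff_distrib mult_ac)
    qed
    also have "(A * q ^ k) * (B * q ^ k) = q * U k"
    proof -
      have "(A * q ^ k) * (B * q ^ k) = (A * B) * (q ^ k * q ^ k)"
        by (simp add: mult_ac)
      thus ?thesis
        unfolding AB by (simp add: U_def mult_2 flip: power_add) (simp add: ac_simps)
    qed
    from cubic_term_x_certificate[OF this, of x]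
    have "(1 - x * q ^ 3 * (U k)\<^sup>2) * (1 - x * U k) * (1 - x * q * U k)
           * (1 - x * q\<^sup>2 * U k) - (1 - x * q) * (1 - x * (U k)\<^sup>2) * R k =
        - x * q\<^sup>2 * U k * N k + x * (1 - U k) * (q - U k) * R k"
      unfolding R_def N_def by (simp add: algebra_simps)
    finally show ?thesis
      by (simp add: G_def algebra_simps)
  qed
  have "(\<Sum>k\<le>K. F k) = 0"
  proof (rule sum_telescope_last)
    fix k assume k: "k < K"
    hence *: "qpoch q q (2 * Suc k + e) \<noteq> 0"
      using nz(3)[of "Suc k"] by simp
    have US: "U (Suc k) = q\<^sup>2 * U k"
      by (simp add: U_def power2_eq_square)
    have "V (Suc k) * (R k * (1 - q * U k) * (1 - q\<^sup>2 * U k)) = V k * (N k * (q * U k))"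
      unfolding V_def R_def N_def U_def using * nz[of k] k by (intro cubic_weight_Suc) auto
    \<comment> \<open>At \<open>Suc k\<close> the certificate factors \<open>(1 - u) (q - u)\<close>
      become \<open>q (1 - q u) (1 - q^2 u)\<close>, which contains exactly the two factors gained
      by \<open>qpoch q q\<close>.\<close>
    moreover have "q - q\<^sup>2 * U k = q * (1 - q * U k)"
      by (simp add: algebra_simps power2_eq_square)
    hence "G (Suc k) * R k = - x * q * (V (Suc k) * (R k * (1 - q * U k) * (1 - q\<^sup>2 * U k)))"
      unfolding G_def US by (simp add: mult_ac)
    ultimately have "G (Suc k) * R k = - x * q\<^sup>2 * U k * V k * N k"
      by (simp add: mult_ac power2_eq_square)
    hence "F k * R k = (G (Suc k) - G k) * R k"
      using FR[of k] k by (simp add: algebra_simps)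
    thus "F k = G (Suc k) - G k"
      using nzR[of k] k by simp
  next
    \<comment> \<open>If \<open>V K\<close> is not already zero, one of the last two factors of the
      vanishing symbol is, and both of them occur in \<open>N K\<close>.\<close>
    have "qpoch x q (2 * Suc K + e) = qpoch x q (2 * K + e) * ((1 - x * U K) * (1 - x * q * U K))"
      by (simp add: qpoch_Suc U_def mult_ac)
    hence "V K * N K = 0"
      using x(1) by (auto simp: V_def cubic_weight_def N_def)
    hence "F K * R K = - G K * R K"
      using FR[of K] by (simp add: mult.assoc)
    thus "F K = - G K"
      using nzR[of K] by (metis mult_right_cancel order_refl)
  next
    \<comment> \<open>\<open>U 0 = q ^ e\<close>, so \<open>1 - U 0\<close> vanishes for
      \<open>e = 0\<close> and \<open>q - U 0\<close> for \<open>e = 1\<close>: one certificate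
      serves both sums.\<close>
    from e have "e = 0 \<or> e = 1" by auto
    thus "G 0 = 0"
      by (auto simp: G_def U_def)
  qed
  hence "(1 - x * q) * (\<Sum>k\<le>K. cubic_term e A B x q k) = 0"
    using S by (simp add: F_def sum_subtractf flip: sum_distrib_left)
  thus ?thesis
    using x(2) by simp
qed

section \<open>Vanishing of the cubic sum when x is a negative power of q\<close>

lemma qpoch_neg_power_eq_0:
  fixes q :: "'a::field"
  assumes "q \<noteq> 0" "M < k"
  shows "qpoch (inverse q ^ M) q k = 0"
  using assms by (auto simp: qpoch_eq_0_iff power_inverse intro!: exI[of _ M])

lemma cubic_term_eq_0:
  assumes "qpoch x q (2 * k + e) = 0"
  shows "cubic_term e A B x q k = 0"
  using assms by (simp add: cubic_term_def cubic_weight_def)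

text \<open>Descent in \<open>M\<close> by steps of three, using the recurrence in \<open>x\<close>,
  down to \<open>M = 0\<close> or \<open>M = 2\<close>. The residue 1 modulo 3 would lead to
  \<open>x = 1/q\<close>, where \<open>1 - x q\<close> cannot be divided out. Since
  \<open>norm q = 1\<close> and \<open>norm A \<noteq> 1\<close>, no base-\<open>q^3\<close>
  denominator can vanish.\<close>

lemma sum_cubic_x_eq_0:
  fixes q A B :: "'a::real_normed_field"
  assumes AB: "A * B = q ^ Suc e" and e: "e \<le> 1"
    and q: "norm q = 1" and A: "norm A \<noteq> 1"
    and nzq: "\<And>i. 0 < i \<Longrightarrow> i \<le> 2 * K + e \<Longrightarrow> q ^ i \<noteq> 1"
    and M: "M \<le> 2 * K + e + 1" "M mod 3 \<noteq> 1"
  shows "(\<Sum>k\<le>K. cubic_term e A B (inverse q ^ M) q k) = 0"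
  using M
proof (induction M rule: less_induct)
  case (less M)
  from q have q0: "q \<noteq> 0" by auto
  have "norm A * norm B = 1"
    using arg_cong[OF AB, of norm] by (simp add: norm_mult norm_power q)
  with A have B: "norm B \<noteq> 1" by auto
  have nzq': "qpoch q q k \<noteq> 0" if "k \<le> 2 * K + e" for k
    using nzq[of "Suc j" for j] that by (auto simp: qpoch_eq_0_iff)
  have nz: "qpoch (inverse q ^ m * q ^ l * C) (q ^ 3) k \<noteq> 0" if "norm C \<noteq> 1" for C :: 'a and m l k
  proof
    assume "qpoch (inverse q ^ m * q ^ l * C) (q ^ 3) k = 0"
    then obtain j where "inverse q ^ m * q ^ l * C * (q ^ 3) ^ j = 1"
      by (auto simp: qpoch_eq_0_iff)
    from arg_cong[OF this, of norm] that show False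
      by (simp add: norm_mult norm_power norm_inverse q)
  qed
  consider "M = 0" | "M = 2" | m where "M = m + 3"
  proof -
    assume a: thesis if "M = 0"
    assume b: thesis if "M = 2"
    assume c: thesis if "M = m + 3" for m
    show thesis
    proof (cases "M < 3")
      case True
      hence "M = 0 \<or> M = 1 \<or> M = 2" by auto
      thus ?thesis using a b less.prems by auto
    next
      case False
      hence "M = (M - 3) + 3" by simp
      thus ?thesis by (rule c)
    qed
  qed
  thus ?case
  proof cases
    case 1
    \<comment> \<open>At \<open>x = 1\<close> every symbol in \<open>x\<close> of positive length
      vanishes; if the length \<open>2 * k + e\<close> is zero, the factor \<open>1 - x\<close>
      vanishes instead.\<close>
    have "cubic_term e A B (inverse q ^ M) q k = 0" for k
    proof (cases "2 * k + e = 0")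
      case True
      thus ?thesis by (simp add: 1 cubic_term_def)
    next
      case False
      thus ?thesis by (intro cubic_term_eq_0 qpoch_neg_power_eq_0) (simp_all add: 1 q0)
    qed
    thus ?thesis by simp
  next
    case 2
    have z: "cubic_term e A B (inverse q ^ M) q k = 0" if "k \<ge> 2" for k
      using that by (intro cubic_term_eq_0 qpoch_neg_power_eq_0) (simp_all add: 2 q0)
    show ?thesis
    proof (cases "e = 0")
      case True
      with less.prems 2 have "K \<ge> 1" by simp
      then obtain K' where K': "K = Suc K'" by (cases K) auto
      have nq: "q \<noteq> 1" "q\<^sup>2 \<noteq> 1"
        using nzq[of 1] nzq[of 2] \<open>K \<ge> 1\<close> by auto
      have nAB: "A \<noteq> 1" "B \<noteq> 1" using A B by auto
      \<comment> \<open>The terms \<open>k = 0\<close> and \<open>k = 1\<close> survive and cancel: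
        \<open>x q^2 = 1\<close> turns the base-\<open>q^3\<close> denominators into
        \<open>(1 - A) (1 - B)\<close>, which the numerator contains.\<close>
      have "(\<Sum>k\<le>K. cubic_term e A B (inverse q ^ M) q k) = (\<Sum>k\<le>Suc 0. cubic_term e A B (inverse q ^ M) q k)"
        using \<open>K \<ge> 1\<close> by (intro sum.mono_neutral_right ballI z) auto
      also have "\<dots> = (1 - inverse q ^ 2) + (1 - inverse q ^ 2 * q ^ 4) * ((1 - A) * (1 - B)
          * ((1 - inverse q ^ 2) * (1 - inverse q)) * q / ((1 - A) * (1 - B) * ((1 - q) * (1 - q\<^sup>2))))"
      proof -
        have "cubic_term 0 A B x q (Suc 0) = (1 - x * q ^ 4) * ((1 - A) * (1 - B) * ((1 - x) * (1 - x * q)) * q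
            / ((1 - x * q ^ 2 * A) * (1 - x * q ^ 2 * B) * ((1 - q) * (1 - q\<^sup>2))))" for x
          by (simp add: cubic_term_def cubic_weight_def qpoch_Suc eval_nat_numeral)
        moreover have "inverse q ^ 2 * q ^ 2 = 1" "inverse q ^ 2 * q = inverse q"
          using q0 by (auto simp: field_simps power2_eq_square)
        ultimately have "cubic_term 0 A B (inverse q ^ 2) q (Suc 0) = (1 - inverse q ^ 2 * q ^ 4) * ((1 - A) * (1 - B)
          * ((1 - inverse q ^ 2) * (1 - inverse q)) * q / ((1 - A) * (1 - B) * ((1 - q) * (1 - q\<^sup>2))))"
          by (metis mult_1)
        thus ?thesis
          by (simp add: 2 True cubic_term_def[of 0 A B _ q 0] cubic_weight_def)
      qed
      also have "\<dots> = (1 - inverse q ^ 2) * (1 + (1 - q\<^sup>2) * ((1 - inverse q) * q / ((1 - q) * (1 - q\<^sup>2))))"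
      proof -
        have "inverse q ^ 2 * q ^ 4 = q ^ 2"
          using q0 by (simp add: field_simps eval_nat_numeral)
        moreover have "(1 - A) * (1 - B) * X * q / ((1 - A) * (1 - B) * D) = X * q / D" for X D
          using nAB by simp
        ultimately show ?thesis
          using nAB by (simp add: distrib_left mult_ac)
      qed
      also have "(1 - inverse q) * q = - (1 - q)"
        using q0 by (simp add: algebra_simps)
      also have "- (1 - q) / ((1 - q) * (1 - q\<^sup>2)) = - 1 / (1 - q\<^sup>2)"
        using nq by (simp add: divide_simps)
      also have "(1 - inverse q ^ 2) * (1 + (1 - q\<^sup>2) * (- 1 / (1 - q\<^sup>2))) = 0"
        using nq by simp
      finally show ?thesis .
    next
      case False
      with e have e1: "e = 1" by simp
      \<comment> \<open>For \<open>k = 0\<close> the factor \<open>1 - x q^2\<close> is zero; for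
        larger \<open>k\<close> the symbol in \<open>x\<close> has length at least 3.\<close>
      have "cubic_term e A B (inverse q ^ M) q k = 0" for k
      proof (cases "k = 0")
        case True
        thus ?thesis using q0 by (simp add: 2 e1 cubic_term_def field_simps)
      next
        case False
        thus ?thesis using q0 by (intro cubic_term_eq_0 qpoch_neg_power_eq_0) (simp_all add: 2 e1)
      qed
      thus ?thesis by simp
    qed
  next
    case (3 m)
    have x: "inverse q ^ M * q ^ 3 = inverse q ^ m"
    proof -
      have "inverse q ^ 3 * q ^ 3 = 1"
        using q0 by (simp flip: power_mult_distrib)
      thus ?thesis by (simp add: 3 power_add mult.assoc)
    qed
    have "q ^ (m + 2) \<noteq> 1"
      using less.prems 3 by (intro nzq) auto
    hence "inverse q ^ M * q \<noteq> 1"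
      using q0 by (simp add: 3 power_add eval_nat_numeral field_simps)
    moreover have "(\<Sum>k\<le>K. cubic_term e A B (inverse q ^ M * q ^ 3) q k) = 0"
      unfolding x using less.prems 3 by (intro less.IH) auto
    moreover have "qpoch (inverse q ^ M) q (2 * Suc K + e) = 0"
      using less.prems q0 by (intro qpoch_neg_power_eq_0) auto
    ultimately show ?thesis
      by (rule cubic_term_x_step[OF AB e nz[OF A] nz[OF B] nzq'[OF order_refl], rotated])
  qed
qed

subsection \<open>The recurrence in a and the terminating evaluation\<close>

text \<open>The telescoping identity for the recurrence in \<open>a\<close>, with
  \<open>p = b q^k\<close>, \<open>v = a / b\<close> and \<open>u = q^(2k)\<close>. The relation
  \<open>a b q^2 = 1\<close> takes the form of the assumption on \<open>u\<close>, and eliminating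
  \<open>u\<close> leaves a polynomial identity. The factor \<open>1 - u\<close> of the certificate
  kills the lower boundary term.\<close>

lemma cubic_term_a_certificate:
  fixes q :: "'a::field"
  assumes "u = q\<^sup>2 * v * p\<^sup>2"
  shows "(1 - v * p) * (1 - q * (v * p)) * (1 - q\<^sup>2 * (v * p)) * (1 - x * q\<^sup>2 * u * p) * (1 - x * u\<^sup>2)
       - v * (1 - p) * (1 - q * p) * (1 - q\<^sup>2 * p) * (1 - x * q\<^sup>2 * u * (v * p)) * (1 - x * u\<^sup>2) =
     - ((1 - v) * (q * u * (1 - v * p) * (1 - p) * (1 - x * u) * (1 - x * q * u)))
       + (1 - v) * (1 - u) * (1 - q * v * p\<^sup>2) * (1 - x * q\<^sup>2 * u * p) * (1 - x * q\<^sup>2 * u * (v * p))"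
  unfolding assms by (simp add: algebra_simps eval_nat_numeral)

lemma qpoch_ratio:
  fixes q :: "'a::field"
  assumes "qpoch a q (Suc k) \<noteq> 0"
  shows "(1 - a * q ^ k) / qpoch (a * q) q k = (1 - a) / qpoch a q k"
proof -
  have "(1 - a) * qpoch (a * q) q k \<noteq> 0"
    using assms by (simp add: qpoch_shift qpoch_Suc)
  hence "qpoch (a * q) q k \<noteq> 0"
    by auto
  thus ?thesis
    using assms qpoch_shift[of a q k] by (simp add: qpoch_Suc divide_simps mult_ac)
qed

text \<open>By \<open>a b q^2 = 1\<close> the parameter pairs \<open>(a q^3, b)\<close> and
  \<open>(a, b q^3)\<close> both have product \<open>q\<close>, so two instances of the same sum are
  linked. Both summands are rational multiples of one weight \<open>V\<close>, with
  \<open>a\<close>, \<open>b\<close> in the numerator and \<open>a\<close>, \<open>b q^3\<close> in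
  the denominator. The upper boundary term vanishes because
  \<open>qpoch b q (Suc K) = 0\<close>.\<close>

lemma cubic_term_a_step:
  fixes q :: "'a::field"
  assumes ab: "a * b * q\<^sup>2 = 1"
    and nz: "qpoch (x * q\<^sup>2 * a) (q ^ 3) (Suc K) \<noteq> 0"
      "qpoch (x * q\<^sup>2 * b) (q ^ 3) (Suc (Suc K)) \<noteq> 0"
    and nzq: "qpoch q q (2 * K) \<noteq> 0"
    and P: "(1 - a) * (1 - a * q) * (1 - a * q\<^sup>2) \<noteq> 0"
    and b: "qpoch b q (Suc K) = 0"
  shows "(1 - x * q\<^sup>2 * b) * (\<Sum>k\<le>K. cubic_term 0 (a * q ^ 3) b x q k) * (a * q)
    = - (1 - x * q\<^sup>2 * a) * (\<Sum>k\<le>K. cubic_term 0 a (b * q ^ 3) x q k)"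
proof -
  have nz0: "q \<noteq> 0" "a \<noteq> 0" "b \<noteq> 0"
    using ab by auto
  \<comment> \<open>\<open>v\<close> is \<open>a / b\<close>, rewritten by means of
    \<open>a * b * q\<^sup>2 = 1\<close>.\<close>
  define v where "v = a\<^sup>2 * q\<^sup>2"
  define U where "U = (\<lambda>k. q ^ (2 * k))"
  define V where "V = cubic_weight 0 a b a (b * q ^ 3) x q"
  define \<beta> where "\<beta> = (\<lambda>k. b * q ^ k)"
  have a_v: "a = v * b"
  proof -
    have "v * b = a * (a * b * q\<^sup>2)"
      by (simp add: v_def power2_eq_square mult_ac)
    thus ?thesis using ab by simp
  qed
  have \<alpha>: "a * q ^ k = v * \<beta> k" for k
    by (subst a_v) (simp add: \<beta>_def)
  have U_\<beta>: "U k = q\<^sup>2 * v * (\<beta> k)\<^sup>2" for k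
  proof -
    have "U k = (a * b * q\<^sup>2)\<^sup>2 * U k"
      using ab by simp
    thus ?thesis
      by (simp add: v_def \<beta>_def U_def power_mult_distrib mult_ac flip: power_mult)
  qed
  define Pa where "Pa = (1 - a) * (1 - a * q) * (1 - a * q\<^sup>2)"
  define Pb where "Pb = (1 - b) * (1 - b * q) * (1 - b * q\<^sup>2)"
  define la where "la = 1 - x * q\<^sup>2 * a"
  define lb where "lb = 1 - x * q\<^sup>2 * b"
  define ra where "ra = (\<lambda>k. 1 - x * q\<^sup>2 * U k * (v * \<beta> k))"
  define rb where "rb = (\<lambda>k. 1 - x * q\<^sup>2 * U k * \<beta> k)"
  define G where "G = (\<lambda>k. - ((1 - v) * (1 - U k) * (1 - q * v * (\<beta> k)\<^sup>2) * rb k * V k))"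
  \<comment> \<open>The coefficients are chosen so that \<open>F k * ra k\<close> is
    \<open>V k\<close> times the left-hand side of the certificate.\<close>
  define F where "F = (\<lambda>k. Pa * (lb / la) * cubic_term 0 (a * q ^ 3) b x q k
                          - v * (Pb * cubic_term 0 a (b * q ^ 3) x q k))"
  have nz': "qpoch (x * q\<^sup>2 * a) (q ^ 3) (Suc k) \<noteq> 0"
    "qpoch (x * q\<^sup>2 * b) (q ^ 3) (Suc (Suc k)) \<noteq> 0" "qpoch q q (2 * k) \<noteq> 0"
    if "k \<le> K" for k
    using nz nzq that qpoch_eq_0_mono[of _ _ "Suc k" "Suc K"]
      qpoch_eq_0_mono[of _ _ "Suc (Suc k)" "Suc (Suc K)"]
      qpoch_eq_0_mono[of q q "2 * k" "2 * K"] by auto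
  have ra: "1 - x * q\<^sup>2 * a * (q ^ 3) ^ k = ra k" for k
    using qpoch_cube_factor[of x q 0 a k] by (simp add: ra_def U_def \<alpha>)
  have rb: "1 - x * q\<^sup>2 * b * (q ^ 3) ^ k = rb k" for k
    using qpoch_cube_factor[of x q 0 b k] by (simp add: rb_def U_def \<beta>_def)
  have ran: "ra k \<noteq> 0" and rbn: "rb k \<noteq> 0" if "k \<le> K" for k
    using nz'[OF that] by (simp_all add: qpoch_Suc ra rb)
  have lan: "la \<noteq> 0" and lbn: "lb \<noteq> 0"
    using ran[of 0] rbn[of 0] by (simp_all add: la_def lb_def flip: ra rb)
  have cubic_term_a: "Pa * (lb / la) * cubic_term 0 (a * q ^ 3) b x q k * ra k = 
      V k * (1 - x * (U k)\<^sup>2) * ((1 - v * \<beta> k) * (1 - q * (v * \<beta> k)) * (1 - q\<^sup>2 * (v * \<beta> k))) * rb k"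
    if k: "k \<le> K" for k
  proof -
    have 1: "ra k / qpoch (x * q\<^sup>2 * (a * q ^ 3)) (q ^ 3) k = la / qpoch (x * q\<^sup>2 * a) (q ^ 3) k"
      using qpoch_ratio[OF nz'(1)[OF k], unfolded ra] by (simp add: la_def mult.assoc)
    have 2: "rb k / qpoch (x * q\<^sup>2 * (b * q ^ 3)) (q ^ 3) k = lb / qpoch (x * q\<^sup>2 * b) (q ^ 3) k"
    proof -
      have "qpoch (x * q\<^sup>2 * b) (q ^ 3) (Suc k) \<noteq> 0"
        using nz'(2)[OF k] by (auto simp: qpoch_Suc)
      from qpoch_ratio[OF this, unfolded rb] show ?thesis
        by (simp add: lb_def mult.assoc)
    qed
    have 3: "Pa * qpoch (a * q ^ 3) q k =
        qpoch a q k * ((1 - v * \<beta> k) * (1 - q * (v * \<beta> k)) * (1 - q\<^sup>2 * (v * \<beta> k)))"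
      using qpoch_shift3[of a q k] by (simp add: Pa_def mult_ac flip: \<alpha>)
    have "Pa * (lb / la) * cubic_term 0 (a * q ^ 3) b x q k * ra k =
      (1 - x * (U k)\<^sup>2) * (Pa * qpoch (a * q ^ 3) q k) * qpoch b q k * qpoch x q (2 * k) * q ^ k\<^sup>2
       / qpoch q q (2 * k) * (lb / qpoch (x * q\<^sup>2 * b) (q ^ 3) k)
       * (ra k / qpoch (x * q\<^sup>2 * (a * q ^ 3)) (q ^ 3) k / la)"
      by (simp add: cubic_term_def cubic_weight_def U_def mult_ac)
    also have "\<dots> = V k * (1 - x * (U k)\<^sup>2) * ((1 - v * \<beta> k) * (1 - q * (v * \<beta> k)) * (1 - q\<^sup>2 * (v * \<beta> k))) * rb k"
      unfolding 1 3 2 [symmetric] V_def cubic_weight_def using lan by (simp add: mult_ac)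
    finally show ?thesis .
  qed
  have cubic_term_b: "Pb * cubic_term 0 a (b * q ^ 3) x q k = 
      V k * (1 - x * (U k)\<^sup>2) * ((1 - \<beta> k) * (1 - q * \<beta> k) * (1 - q\<^sup>2 * \<beta> k))" for k
  proof -
    have 3: "Pb * qpoch (b * q ^ 3) q k =
        qpoch b q k * ((1 - \<beta> k) * (1 - q * \<beta> k) * (1 - q\<^sup>2 * \<beta> k))"
      using qpoch_shift3[of b q k] by (simp add: Pb_def \<beta>_def mult_ac)
    have "Pb * cubic_term 0 a (b * q ^ 3) x q k = (1 - x * (U k)\<^sup>2) * (qpoch a q k * (Pb * qpoch (b * q ^ 3) q k)
       * qpoch x q (2 * k) * q ^ k\<^sup>2 / (qpoch (x * q\<^sup>2 * a) (q ^ 3) k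
         * qpoch (x * q\<^sup>2 * (b * q ^ 3)) (q ^ 3) k * qpoch q q (2 * k)))"
      by (simp add: cubic_term_def cubic_weight_def U_def mult_ac)
    thus ?thesis
      unfolding 3 V_def cubic_weight_def by (simp add: mult_ac)
  qed
  define N where "N = (\<lambda>k. (1 - v * \<beta> k) * (1 - \<beta> k) * (1 - x * U k) * (1 - x * q * U k))"
  have FR: "F k * ra k = - (1 - v) * q * U k * V k * N k - G k * ra k" if "k \<le> K" for k
  proof -
    have gen: "V * c * n * r - v * (V * c * (m1 * m2 * m3)) * r' =
        V * (n * r * c - v * m1 * m2 * m3 * r' * c)" for V c n r v m1 m2 m3 r' :: 'a
      by (simp add: algebra_simps)
    have "F k * ra k = Pa * (lb / la) * cubic_term 0 (a * q ^ 3) b x q k * ra k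
        - v * (Pb * cubic_term 0 a (b * q ^ 3) x q k) * ra k"
      unfolding F_def by (rule left_diff_distrib)
    also have "\<dots> = V k * ((1 - v * \<beta> k) * (1 - q * (v * \<beta> k)) * (1 - q\<^sup>2 * (v * \<beta> k)) * rb k * (1 - x * (U k)\<^sup>2)
       - v * (1 - \<beta> k) * (1 - q * \<beta> k) * (1 - q\<^sup>2 * \<beta> k) * ra k * (1 - x * (U k)\<^sup>2))"
      unfolding cubic_term_a[OF that] cubic_term_b by (rule gen)
    also have "\<dots> = V k * (- ((1 - v) * (q * U k * (1 - v * \<beta> k) * (1 - \<beta> k) * (1 - x * U k) * (1 - x * q * U k)))
       + (1 - v) * (1 - U k) * (1 - q * v * (\<beta> k)\<^sup>2) * rb k * ra k)"
      unfolding ra_def rb_def by (subst cubic_term_a_certificate[OF U_\<beta>]) (rule refl)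
    also have "\<dots> = - (1 - v) * q * U k * V k * N k - G k * ra k"
    proof -
      have "V * (- (w * (q * u * a * b * c * d)) + w * e * f * r * r') =
          - w * q * u * V * (a * b * c * d) - (- (w * e * f * r * V)) * r'"
        for V w u a b c d e f r r' :: 'a
        by (simp add: algebra_simps)
      thus ?thesis unfolding G_def N_def .
    qed
    finally show ?thesis .
  qed
  have "(\<Sum>k\<le>K. F k) = 0"
  proof (rule sum_telescope_last)
    fix k assume k: "k < K"
    have nzS: "qpoch q q (2 * Suc k + 0) \<noteq> 0"
      using nz'(3)[of "Suc k"] k by simp
    have US: "U (Suc k) = q\<^sup>2 * U k" "\<beta> (Suc k) = q * \<beta> k"
      by (simp_all add: U_def \<beta>_def power2_eq_square)
    have rb': "1 - x * q\<^sup>2 * U k * (b * q ^ 3 * q ^ k) = rb (Suc k)"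
      by (simp add: rb_def US) (simp add: \<beta>_def eval_nat_numeral mult_ac)
    have "qpoch (x * q\<^sup>2 * (b * q ^ 3)) (q ^ 3) (Suc k) \<noteq> 0"
      using qpoch_shift[of "x * q\<^sup>2 * b" "q ^ 3" "Suc k"] nz'(2)[of k] k
      by (auto simp: qpoch_Suc[of _ _ "Suc k"] mult.assoc)
    hence "V (Suc k) * (ra k * rb (Suc k) * (1 - q * U k) * (1 - q\<^sup>2 * U k)) = V k * (N k * (q * U k))"
      using cubic_weight_Suc[OF nzS, of x a "b * q ^ 3" a b] nz'[of k] k
      by (simp add: V_def N_def rb' [symmetric] \<alpha> ra_def U_def) (simp add: \<beta>_def)
    moreover have bS: "q * v * (\<beta> (Suc k))\<^sup>2 = q * U k"
      unfolding US U_\<beta>[of k] by (simp add: power2_eq_square mult_ac)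
    have "G (Suc k) * ra k = - ((1 - v) * (V (Suc k) * (ra k * rb (Suc k) * (1 - q * U k) * (1 - q\<^sup>2 * U k))))"
      unfolding G_def bS unfolding US(1) by (simp add: mult_ac)
    ultimately have "G (Suc k) * ra k = - ((1 - v) * (V k * (N k * (q * U k))))"
      by simp
    hence "G (Suc k) * ra k = - (1 - v) * q * U k * V k * N k"
      by (simp only: mult_minus_left mult_minus_right mult_ac)
    hence "F k * ra k = (G (Suc k) - G k) * ra k"
      using FR[of k] k by (simp add: left_diff_distrib)
    thus "F k = G (Suc k) - G k"
      using ran[of k] k by simp
  next
    have "V K * N K = 0"
      using b by (auto simp: V_def cubic_weight_def N_def qpoch_Suc \<beta>_def)
    hence "F K * ra K = (- G K) * ra K"
      using FR[of K] by (simp add: mult.assoc)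
    thus "F K = - G K"
      using ran[of K] by (metis mult_right_cancel order_refl)
  qed (simp add: G_def U_def)
  hence "Pa * (lb / la) * (\<Sum>k\<le>K. cubic_term 0 (a * q ^ 3) b x q k)
      = v * Pb * (\<Sum>k\<le>K. cubic_term 0 a (b * q ^ 3) x q k)"
    unfolding F_def sum_subtractf sum_distrib_left [symmetric] by (simp only: right_minus_eq mult.assoc)
  \<comment> \<open>Since \<open>a b q^2 = 1\<close>,
    \<open>a q^(2-i) (1 - b q^i) = -(1 - a q^(2-i))\<close> for \<open>i = 0, 1, 2\<close>; this
    turns \<open>Pb\<close> into \<open>Pa\<close>, which then cancels from the relation.\<close>
  moreover have "v * Pb * (a * q) = - Pa"
  proof -
    have "v * Pb * (a * q) = (a * q\<^sup>2 * (1 - b)) * (a * q * (1 - b * q)) * (a * (1 - b * q\<^sup>2))"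
      by (simp add: v_def Pb_def power2_eq_square mult_ac)
    moreover have "a * q\<^sup>2 * (1 - b) = - (1 - a * q\<^sup>2)" "a * q * (1 - b * q) = - (1 - a * q)"
        "a * (1 - b * q\<^sup>2) = - (1 - a)"
      using ab by (simp_all add: right_diff_distrib mult_ac power2_eq_square)
    ultimately have "v * Pb * (a * q) = (- (1 - a * q\<^sup>2)) * (- (1 - a * q)) * (- (1 - a))"
      by (simp only:)
    thus ?thesis
      unfolding Pa_def by (simp only: mult_minus_left mult_minus_right minus_minus mult_ac)
  qed
  ultimately have "Pa * (lb / la) * (\<Sum>k\<le>K. cubic_term 0 (a * q ^ 3) b x q k) * (a * q) =
      - Pa * (\<Sum>k\<le>K. cubic_term 0 a (b * q ^ 3) x q k)"
    by (metis mult.assoc mult.commute[of "a * q"])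
  hence "Pa * (lb * (\<Sum>k\<le>K. cubic_term 0 (a * q ^ 3) b x q k) * (a * q)) =
      Pa * (- la * (\<Sum>k\<le>K. cubic_term 0 a (b * q ^ 3) x q k))"
    using lan by (simp add: divide_simps mult_ac)
  thus ?thesis
    using P unfolding Pa_def [symmetric] la_def [symmetric] lb_def [symmetric]
    by (metis mult_left_cancel)
qed

text \<open>The nontrivial Dirichlet character modulo 3, which agrees with the Kronecker symbol of
  -3 on numbers coprime with 6.\<close>

definition chi_3 :: "nat \<Rightarrow> int" where
  "chi_3 n = (if n mod 3 = 0 then 0 else if n mod 3 = 1 then 1 else -1)"

lemma chi_3_add_6: "chi_3 (n + 6) = chi_3 n"
  by (simp add: chi_3_def mod_add_eq [symmetric])

lemma cubic_term_eq_0_right: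
  assumes "qpoch B q k = 0"
  shows "cubic_term e A B x q k = 0"
  using assms by (simp add: cubic_term_def cubic_weight_def)

lemma power_eq_power_iff:
  fixes z :: "'a::field"
  assumes "z \<noteq> 0" and "\<And>i. 0 < i \<Longrightarrow> z ^ i \<noteq> 1"
  shows "z ^ i = z ^ j \<longleftrightarrow> i = j"
proof -
  have *: "i = j" if "z ^ i = z ^ j" "i \<le> j" for i j
  proof (rule ccontr)
    assume "i \<noteq> j"
    have "z ^ j = z ^ i * z ^ (j - i)"
      using that(2) by (simp flip: power_add)
    with assms that \<open>i \<noteq> j\<close> show False by auto
  qed
  show ?thesis
    using *[of i j] *[of j i] by (cases "i \<le> j") auto
qed

text \<open>This is the deformed sum at \<open>a = z^n\<close>, in base \<open>z^2\<close> with
  \<open>x = z\<close>. For odd \<open>n\<close> the second numerator symbol vanishes once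
  \<open>2 k > n\<close>, so every admissible \<open>K\<close> gives the same sum. The recurrence in
  \<open>a\<close> multiplies \<open>z^n\<close> by \<open>z^6\<close>, hence an induction in steps
  of 6 from \<open>n = 1\<close> and \<open>n = 5\<close>, the two residues coprime with 6.\<close>

theorem sum_cubic_terminating:
  fixes z :: "'a::field"
  assumes z0: "z \<noteq> 0" and z: "\<And>i. 0 < i \<Longrightarrow> z ^ i \<noteq> 1"
    and n: "odd n" "n mod 3 \<noteq> 0" and K: "n \<le> 2 * K"
  shows "z ^ ((n - 1) div 2) * (\<Sum>k\<le>K. cubic_term 0 (z ^ Suc n) (z * inverse (z ^ n)) z (z\<^sup>2) k)
           = (1 - z ^ n) * of_int (chi_3 n)"
  using n K
proof (induction n arbitrary: K rule: less_induct)
  case (less n)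
  have pw: "z ^ i = z ^ j \<longleftrightarrow> i = j" for i j
    by (rule power_eq_power_iff[OF z0 z])
  have pw1: "z ^ i = 1 \<longleftrightarrow> i = 0" for i
    using pw[of i 0] by simp
  have z1: "z \<noteq> 1" using z[of 1] by simp
  have z5: "z * z ^ 4 = z ^ 5" and z7: "z * z ^ 6 = z ^ 7"
    by (simp_all flip: power_Suc)
  have van: "cubic_term 0 A (z * inverse (z ^ m)) z (z\<^sup>2) k = 0" if "odd m" "m < 2 * k" for m k A
  proof (rule cubic_term_eq_0_right)
    from that obtain j where j: "m = 2 * j + 1" by (elim oddE)
    hence "z * inverse (z ^ m) * (z\<^sup>2) ^ j = 1"
      using z0 by (simp add: field_simps flip: power_mult)
    thus "qpoch (z * inverse (z ^ m)) (z\<^sup>2) k = 0"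
      using j that unfolding qpoch_eq_0_iff by (intro exI[of _ j]) auto
  qed
  consider "n = 1" | "n = 5" | m where "n = m + 6" "odd m" "m mod 3 \<noteq> 0"
  proof -
    assume a: thesis if "n = 1"
    assume b: thesis if "n = 5"
    assume c: thesis if "n = m + 6" "odd m" "m mod 3 \<noteq> 0" for m
    show thesis
    proof (cases "n < 6")
      case True
      hence "n \<in> {0,1,2,3,4,5}" by auto
      thus ?thesis using a b less.prems by auto
    next
      case False
      then obtain m where m: "n = m + 6"
        by (metis add.commute le_Suc_ex not_less)
      have "odd m" "m mod 3 \<noteq> 0"
        using less.prems unfolding m by presburger+
      with m show ?thesis by (rule c)
    qed
  qed
  thus ?case
  proof cases
    case 1
    have "(\<Sum>k\<le>K. cubic_term 0 (z ^ Suc n) (z * inverse (z ^ n)) z (z\<^sup>2) k) =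
          (\<Sum>k\<le>0. cubic_term 0 (z ^ Suc n) (z * inverse (z ^ n)) z (z\<^sup>2) k)"
      using 1 by (intro sum.mono_neutral_right ballI van) auto
    thus ?thesis
      by (simp add: 1 cubic_term_def cubic_weight_def chi_3_def)
  next
    case 2
    have "(\<Sum>k\<le>K. cubic_term 0 (z ^ Suc n) (z * inverse (z ^ n)) z (z\<^sup>2) k) =
          (\<Sum>k\<le>Suc (Suc 0). cubic_term 0 (z ^ Suc n) (z * inverse (z ^ n)) z (z\<^sup>2) k)"
      using 2 less.prems by (intro sum.mono_neutral_right ballI van) auto
    moreover have "z\<^sup>2 * (\<Sum>k\<le>Suc (Suc 0). cubic_term 0 (z ^ Suc n) (z * inverse (z ^ n)) z (z\<^sup>2) k) = - (1 - z ^ 5)"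
    proof -
      \<comment> \<open>Here \<open>B = z^(-4)\<close>. The powers of \<open>z\<close> in front,
        \<open>z^4\<close> for \<open>k = 1\<close> and \<open>z^10\<close> for
        \<open>k = 2\<close>, absorb the negative exponents and leave factors
        \<open>1 - z^i\<close>, most of which cancel.\<close>
      define B where "B = z * inverse (z ^ n)"
      have zz: "(z\<^sup>2) ^ i = z ^ (2 * i)" "z * z ^ i = z ^ Suc i" for i
        by (simp_all add: power_mult)
      have B1: "z ^ 4 * (1 - B) = - (1 - z ^ 4)" "z\<^sup>2 * (1 - B * z\<^sup>2) = - (1 - z\<^sup>2)" "z ^ 5 * B = z"
        using z0 by (simp_all add: B_def 2 field_simps eval_nat_numeral)
      have nz: "1 - z ^ i \<noteq> 0" if "i > 0" for i
        using z[OF that] by simp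
      have n1: "1 - z \<noteq> 0" using z1 by simp
      have "cubic_term 0 (z ^ 6) B z (z\<^sup>2) 0 = 1 - z"
        by (simp add: cubic_term_def cubic_weight_def)
      moreover
      have "z\<^sup>2 * cubic_term 0 (z ^ 6) B z (z\<^sup>2) (Suc 0) =
          (1 - z ^ 9) * (1 - z ^ 6) * (z ^ 4 * (1 - B)) * ((1 - z) * (1 - z ^ 3)) /
           ((1 - z ^ 11) * (1 - z ^ 5 * B) * ((1 - z\<^sup>2) * (1 - z ^ 4)))"
        by (simp add: cubic_term_def cubic_weight_def qpoch_Suc eval_nat_numeral mult_ac)
      note * = this
      have "z\<^sup>2 * cubic_term 0 (z ^ 6) B z (z\<^sup>2) (Suc 0) =
          - ((1 - z ^ 9) * (1 - z ^ 6) * (1 - z ^ 3)) / ((1 - z ^ 11) * (1 - z\<^sup>2))"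
      proof -
        have "N9 * N6 * (- F4) * (F1 * F3) / (E11 * F1 * (F2 * F4)) = - (N9 * N6 * F3) / (E11 * F2)"
          if "F1 \<noteq> 0" "F4 \<noteq> 0" for N9 N6 F1 F2 F3 F4 E11 :: 'a
          using that by simp
        note gen = this[OF n1 nz[of 4, OF zero_less_numeral]]
        from * show ?thesis unfolding B1 gen .
      qed
      moreover have "z\<^sup>2 * cubic_term 0 (z ^ 6) B z (z\<^sup>2) (Suc (Suc 0)) =
          (1 - z ^ 17) * ((1 - z ^ 6) * (1 - z ^ 8)) * ((z ^ 4 * (1 - B)) * (z\<^sup>2 * (1 - B * z\<^sup>2)))
           * ((1 - z) * (1 - z ^ 3) * (1 - z ^ 5) * (1 - z ^ 7)) * z ^ 4 /
           ((1 - z ^ 11) * (1 - z ^ 17) * ((1 - z ^ 5 * B) * (1 - z ^ 5 * B * z ^ 6))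
            * ((1 - z\<^sup>2) * (1 - z ^ 4) * (1 - z ^ 6) * (1 - z ^ 8)))"
        by (simp add: cubic_term_def cubic_weight_def qpoch_Suc eval_nat_numeral mult_ac)
      note ** = this
      have "z\<^sup>2 * cubic_term 0 (z ^ 6) B z (z\<^sup>2) (Suc (Suc 0)) =
          (1 - z ^ 3) * (1 - z ^ 5) * z ^ 4 / (1 - z ^ 11)"
      proof -
        have "E17 * (F6 * F8) * ((- F4) * (- F2)) * (F1 * F3 * F5 * F7) * w /
            (E11 * E17 * (F1 * F7) * (F2 * F4 * F6 * F8)) = F3 * F5 * w / E11"
          if "F1 \<noteq> 0" "F2 \<noteq> 0" "F4 \<noteq> 0" "F6 \<noteq> 0" "F7 \<noteq> 0" "F8 \<noteq> 0" "E17 \<noteq> 0"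
          for F1 F2 F3 F4 F5 F6 F7 F8 E11 E17 w :: 'a
          using that by simp
        note gen = this[OF n1 nz[of 2, OF zero_less_numeral] nz[of 4, OF zero_less_numeral]
          nz[of 6, OF zero_less_numeral] nz[of 7, OF zero_less_numeral]
          nz[of 8, OF zero_less_numeral] nz[of 17, OF zero_less_numeral]]
        from ** show ?thesis unfolding B1 z7 gen .
      qed
      ultimately have "z\<^sup>2 * (\<Sum>k\<le>Suc (Suc 0). cubic_term 0 (z ^ 6) B z (z\<^sup>2) k) =
         z\<^sup>2 * (1 - z) - ((1 - z ^ 9) * (1 - z ^ 6) * (1 - z ^ 3)) / ((1 - z ^ 11) * (1 - z\<^sup>2))
          + (1 - z ^ 3) * (1 - z ^ 5) * z ^ 4 / (1 - z ^ 11)"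
        by (simp add: distrib_left)
      also have "\<dots> = - (1 - z ^ 5)"
      proof -
        have gen: "P - Q / (D * E) + R / D = S" if "P * (D * E) - Q + R * E = S * (D * E)"
          "D \<noteq> 0" "E \<noteq> 0" for P Q R S D E :: 'a
          using that by (simp add: field_simps)
        have "z\<^sup>2 * (1 - z) * ((1 - z ^ 11) * (1 - z\<^sup>2)) - (1 - z ^ 9) * (1 - z ^ 6) * (1 - z ^ 3)
            + (1 - z ^ 3) * (1 - z ^ 5) * z ^ 4 * (1 - z\<^sup>2) = - (1 - z ^ 5) * ((1 - z ^ 11) * (1 - z\<^sup>2))"
          by (simp add: algebra_simps eval_nat_numeral)
        thus ?thesis
          by (rule gen[OF _ nz[of 11, OF zero_less_numeral] nz[of 2, OF zero_less_numeral]])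
      qed
      finally show ?thesis by (simp add: B_def 2)
    qed
    ultimately show ?thesis
      by (simp add: 2 chi_3_def)
  next
    case (3 m)
    \<comment> \<open>In base \<open>z^2\<close> this choice makes \<open>a q^3 = z^(n+1)\<close>
      and \<open>b q^3 = z^(1-m)\<close>, so that \<open>cubic_term_a_step\<close> connects the sums
      for \<open>n\<close> and \<open>m\<close>.\<close>
    define a where "a = z ^ Suc m"
    define b where "b = z * inverse (z ^ (m + 6))"
    have m0: "m > 0" using 3 by (auto intro!: Nat.gr0I)
    have ab: "a * b * (z\<^sup>2)\<^sup>2 = 1"
      using z0 by (simp add: a_def b_def power_add field_simps flip: power_mult) (simp add: eval_nat_numeral)
    have e1: "a * (z\<^sup>2) ^ 3 = z ^ Suc n"
      by (simp add: z7 a_def 3 power_add flip: power_mult)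
    have e2: "b * (z\<^sup>2) ^ 3 = z * inverse (z ^ m)"
      using z0 by (simp add: b_def power_add field_simps flip: power_mult)
    have e3: "b = z * inverse (z ^ n)"
      by (simp add: b_def 3)
    have IH: "z ^ ((m - 1) div 2) * (\<Sum>k\<le>K. cubic_term 0 a (b * (z\<^sup>2) ^ 3) z (z\<^sup>2) k) = (1 - z ^ m) * of_int (chi_3 m)"
      unfolding e2 a_def using 3 less.prems by (intro less.IH) auto
    have "(1 - z * (z\<^sup>2)\<^sup>2 * b) * (\<Sum>k\<le>K. cubic_term 0 (a * (z\<^sup>2) ^ 3) b z (z\<^sup>2) k) * (a * z\<^sup>2)
      = - (1 - z * (z\<^sup>2)\<^sup>2 * a) * (\<Sum>k\<le>K. cubic_term 0 a (b * (z\<^sup>2) ^ 3) z (z\<^sup>2) k)"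
    proof (rule cubic_term_a_step[OF ab])
      have "z * (z\<^sup>2)\<^sup>2 * a * ((z\<^sup>2) ^ 3) ^ j = z ^ (m + 6 + 6 * j)" for j
        by (simp add: a_def power_add flip: power_mult) (simp add: z5 z7 eval_nat_numeral mult_ac)
      thus "qpoch (z * (z\<^sup>2)\<^sup>2 * a) ((z\<^sup>2) ^ 3) (Suc K) \<noteq> 0"
        by (simp add: qpoch_eq_0_iff pw1)
      have "z * (z\<^sup>2)\<^sup>2 * b * ((z\<^sup>2) ^ 3) ^ j * z ^ m = z ^ (6 * j)" for j
        using z0 by (simp add: b_def power_add field_simps flip: power_mult) (simp add: z5 z7 eval_nat_numeral mult_ac)
      \<comment> \<open>A vanishing denominator factor would force \<open>m = 6 j\<close>; this is
        where coprimality with 6 enters.\<close>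
      moreover have "6 * j \<noteq> m" for j
        using 3 by auto
      ultimately have "z * (z\<^sup>2)\<^sup>2 * b * ((z\<^sup>2) ^ 3) ^ j \<noteq> 1" for j
        using pw[of m "6 * j"] by (metis mult_1)
      thus "qpoch (z * (z\<^sup>2)\<^sup>2 * b) ((z\<^sup>2) ^ 3) (Suc (Suc K)) \<noteq> 0"
        by (simp add: qpoch_eq_0_iff)
      show "qpoch (z\<^sup>2) (z\<^sup>2) (2 * K) \<noteq> 0"
      proof -
        have "z\<^sup>2 * (z\<^sup>2) ^ j = z ^ (2 * j + 2)" for j
          unfolding power_add power_mult by (rule mult.commute)
        thus ?thesis by (simp add: qpoch_eq_0_iff pw1 del: power_Suc power_add)
      qed
      show "(1 - a) * (1 - a * z\<^sup>2) * (1 - a * (z\<^sup>2)\<^sup>2) \<noteq> 0"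
        by (auto simp: a_def simp flip: power_mult power_add power_Suc simp: pw1)
      obtain j where j: "m = 2 * j + 1" using 3 by (elim oddE)
      hence "b * (z\<^sup>2) ^ (j + 3) = 1"
        using z0 by (simp add: b_def field_simps z7 power_add flip: power_mult)
      thus "qpoch b (z\<^sup>2) (Suc K) = 0"
        using 3 j less.prems unfolding qpoch_eq_0_iff by (intro exI[of _ "j + 3"]) auto
    qed
    note step = this
    define S1 where "S1 = (\<Sum>k\<le>K. cubic_term 0 (a * (z\<^sup>2) ^ 3) b z (z\<^sup>2) k)"
    define S2 where "S2 = (\<Sum>k\<le>K. cubic_term 0 a (b * (z\<^sup>2) ^ 3) z (z\<^sup>2) k)"
    have "(1 - z * (z\<^sup>2)\<^sup>2 * b) * (a * z\<^sup>2) = - (1 - z ^ m) * z ^ 3"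
      using z0 by (simp add: a_def b_def power_add field_simps flip: power_mult) (simp add: z5 z7 eval_nat_numeral mult_ac)
    moreover have "1 - z * (z\<^sup>2)\<^sup>2 * a = 1 - z ^ n"
      by (simp add: a_def 3 power_add eval_nat_numeral mult_ac)
    ultimately have S12: "(1 - z ^ m) * z ^ 3 * S1 = (1 - z ^ n) * S2"
    proof -
      assume *: "(1 - z * (z\<^sup>2)\<^sup>2 * b) * (a * z\<^sup>2) = - (1 - z ^ m) * z ^ 3"
        "1 - z * (z\<^sup>2)\<^sup>2 * a = 1 - z ^ n"
      have "((1 - z * (z\<^sup>2)\<^sup>2 * b) * (a * z\<^sup>2)) * S1 = - (1 - z * (z\<^sup>2)\<^sup>2 * a) * S2"
        using step unfolding S1_def S2_def by (simp only: mult_ac)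
      thus ?thesis
        unfolding * by (simp only: mult_minus_left neg_equal_iff_equal)
    qed
    obtain j where j: "m = 2 * j + 1" using 3 by (elim oddE)
    \<comment> \<open>The exponent of the prefactor rises by 3, which accounts for
      \<open>z ^ 3\<close> in \<open>S12\<close>.\<close>
    have half: "(n - 1) div 2 = (m - 1) div 2 + 3"
      by (simp add: 3 j)
    have "(1 - z ^ m) * (z ^ ((n - 1) div 2) * S1) = z ^ ((m - 1) div 2) * ((1 - z ^ m) * z ^ 3 * S1)"
      unfolding half power_add by (simp add: mult_ac)
    also have "\<dots> = (1 - z ^ n) * (z ^ ((m - 1) div 2) * S2)"
      unfolding S12 by (simp add: mult_ac)
    also have "\<dots> = (1 - z ^ m) * ((1 - z ^ n) * of_int (chi_3 n))"
      unfolding S2_def IH by (simp add: 3 chi_3_add_6)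
    finally have "z ^ ((n - 1) div 2) * S1 = (1 - z ^ n) * of_int (chi_3 n)"
      using m0 z[of m] by simp
    thus ?thesis
      unfolding S1_def e1 e3 .
  qed
qed

subsection \<open>The Jacobi--Kronecker symbol\<close>

lemma chi_3_mult: "chi_3 (m * n) = chi_3 m * chi_3 n"
proof -
  have "m * n mod 3 = (m mod 3) * (n mod 3) mod 3"
    by (simp add: mod_mult_eq)
  moreover have "m mod 3 \<in> {0, 1, 2}" "n mod 3 \<in> {0, 1, 2}" by auto
  ultimately show ?thesis
    by (auto simp: chi_3_def)
qed

lemma Legendre_3: 
  assumes "p mod 3 \<noteq> 0"
  shows "Legendre (int p) 3 = chi_3 p"
proof -
  have cong: "[a = b] (mod 3) \<longleftrightarrow> a mod 3 = b mod 3" for a b :: int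
    by (rule unique_euclidean_semiring_class.cong_def)
  have p3: "int p mod 3 = int (p mod 3)"
    by (simp add: zmod_int)
  have nd: "\<not> [int p = 0] (mod 3)"
    using assms unfolding cong p3 by simp
  have "QuadRes 3 (int p) \<longleftrightarrow> p mod 3 = 1"
  proof
    assume "QuadRes 3 (int p)"
    then obtain y where y: "[y\<^sup>2 = int p] (mod 3)" by (auto simp: QuadRes_def)
    have "y\<^sup>2 mod 3 = (y mod 3)\<^sup>2 mod 3" by (simp add: power_mod)
    moreover have "y mod 3 \<in> {0, 1, 2}" by auto
    ultimately have "y\<^sup>2 mod 3 \<in> {0, 1}" by auto
    hence "int p mod 3 \<in> {0, 1}" using y by (simp add: cong)
    thus "p mod 3 = 1" using assms by (auto simp: p3)
  next
    assume "p mod 3 = 1"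
    hence "[1\<^sup>2 = int p] (mod 3)" by (simp add: cong p3)
    thus "QuadRes 3 (int p)" unfolding QuadRes_def by blast
  qed
  thus ?thesis
    using nd assms by (auto simp: Legendre_def chi_3_def)
qed

text \<open>Euler's criterion splits off \<open>(-1) ^ h\<close>, which is also the sign in
  quadratic reciprocity for \<open>p\<close> and 3; what remains is the Legendre symbol of
  \<open>p\<close> modulo 3.\<close>

lemma Legendre_minus_3:
  assumes p: "prime p" and p2: "p \<noteq> 2" and p3: "p \<noteq> 3"
  shows "Legendre (-3) (int p) = chi_3 p"
proof -
  define h where "h = (p - 1) div 2"
  have gt: "p > 3"
    using p p2 p3 prime_ge_2_nat[OF p] by linarith
  have nd: "p mod 3 \<noteq> 0"
    using p p3 by (metis mod_0_imp_dvd prime_nat_iff numeral_eq_one_iff semiring_norm(86))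
  have n3: "\<not> [3 = 0] (mod int p)"
    using gt by (auto simp: unique_euclidean_semiring_class.cong_def)
  have e: "[Legendre a p = a ^ h] (mod p)" for a
    using euler_criterion[of p a] p gt by (simp add: h_def)
  have qr: "Legendre (int p) 3 * Legendre 3 (int p) = (-1) ^ h"
    using Quadratic_Reciprocity[of p 3] p gt by (simp add: h_def)
  have L3: "Legendre 3 (int p) \<in> {-1, 1}"
    using n3 by (auto simp: Legendre_def)
  have "[Legendre (-3) p = (-1) ^ h * Legendre 3 p] (mod p)"
  proof -
    have "[(-1) ^ h * Legendre 3 p = (-1) ^ h * 3 ^ h] (mod p)"
      by (intro cong_mult cong_refl e)
    also have "(-1) ^ h * 3 ^ h = (-3 :: int) ^ h"
      by (simp flip: power_mult_distrib)
    finally show ?thesis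
      using e[of "-3"] cong_sym cong_trans by blast
  qed
  also have "(-1) ^ h * Legendre 3 p = Legendre p 3"
    using L3 unfolding qr [symmetric] by auto
  also have "Legendre p 3 = chi_3 p"
    by (rule Legendre_3[OF nd])
  finally have "int p dvd Legendre (-3) p - chi_3 p"
    by (simp add: cong_iff_dvd_diff)
  \<comment> \<open>Two values in \<open>{-1, 0, 1}\<close> that are congruent modulo
    \<open>p > 3\<close> are equal.\<close>
  moreover have "\<bar>Legendre (-3) p - chi_3 p\<bar> < int p"
  proof -
    have "Legendre (-3) p \<in> {-1, 0, 1}" "chi_3 p \<in> {-1, 0, 1}"
      by (simp_all add: Legendre_def chi_3_def)
    with gt show ?thesis by auto
  qed
  ultimately show ?thesis
    using dvd_imp_le_int[of "Legendre (-3) p - chi_3 p" "int p"] by linarith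
qed

lemma kronecker_minus_3:
  assumes "n > 0" "coprime n 6"
  shows "kronecker (-3) n = chi_3 n"
proof -
  have "kronecker_prime (-3) p = chi_3 p" if "p \<in># prime_factorization n" for p
  proof -
    from that have p: "prime p" "p dvd n" by auto
    have "\<not> p dvd 6"
      using p assms(2) by (meson coprime_common_divisor not_prime_unit)
    hence "p \<noteq> 2" "p \<noteq> 3" by auto
    with p show ?thesis
      by (simp add: kronecker_prime_def Legendre_minus_3)
  qed
  hence "kronecker (-3) n = (\<Prod>p\<in>#prime_factorization n. chi_3 p)"
    by (simp add: kronecker_def cong: image_mset_cong)
  also have "(\<Prod>p\<in>#A. chi_3 p) = chi_3 (\<Prod>\<^sub># A)" for A
    by (induction A) (simp_all add: chi_3_mult, simp add: chi_3_def)
  also have "\<Prod>\<^sub># (prime_factorization n) = n"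
    using assms(1) by (simp add: prod_mset_prime_factorization_nat)
  finally show ?thesis .
qed

subsection \<open>The deformed sum at roots of unity\<close>

text \<open>
  For \<open>y = (1-a)\<^sup>2/a\<close> and \<open>m = r + s j\<close> this is \<open>(1 - a z\<^sup>m) (1 - z\<^sup>m/a)\<close>.
\<close>

definition pair_factor :: "nat \<Rightarrow> nat \<Rightarrow> 'a::comm_ring_1 \<Rightarrow> 'a \<Rightarrow> nat \<Rightarrow> 'a" where
  "pair_factor r s y z j = (1 - z ^ (r + s * j))\<^sup>2 - y * z ^ (r + s * j)"

text \<open>The deformed sum multiplied by its common denominator, the product of all
  \<open>pair_factor 6 6 y z j\<close> with \<open>j < M\<close>; the result is a polynomial in
  \<open>y\<close>.\<close>

definition num_sum :: "(nat \<Rightarrow> 'a::comm_ring_1) \<Rightarrow> 'a \<Rightarrow> nat \<Rightarrow> 'a \<Rightarrow> 'a" where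
  "num_sum c z M y =
     (\<Sum>k\<le>M. c k * (\<Prod>j<k. pair_factor 1 2 y z j) * (\<Prod>j\<in>{k..<M}. pair_factor 6 6 y z j))"

text \<open>The part of the deformed summand that depends on \<open>a\<close>. It is invariant under
  \<open>a -> 1/a\<close>, hence a function of \<open>y\<close>; at \<open>a = 1\<close> it is the
  original quotient of squares.\<close>

definition tpoch :: "'a::field \<Rightarrow> 'a \<Rightarrow> nat \<Rightarrow> 'a" where
  "tpoch a z k = qpoch (a * z) (z\<^sup>2) k * qpoch (z * inverse a) (z\<^sup>2) k /
     (qpoch (a * z ^ 6) (z ^ 6) k * qpoch (z ^ 6 * inverse a) (z ^ 6) k)"

lemma prod_pair_factor:
  fixes a z :: "'a::field"
  assumes "a \<noteq> 0"
  shows "(\<Prod>j<k. pair_factor r s ((1 - a)\<^sup>2 * inverse a) z j) =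
           qpoch (a * z ^ r) (z ^ s) k * qpoch (z ^ r * inverse a) (z ^ s) k"
proof -
  have "pair_factor r s ((1 - a)\<^sup>2 * inverse a) z j =
      (1 - a * z ^ r * (z ^ s) ^ j) * (1 - z ^ r * inverse a * (z ^ s) ^ j)" for j
  proof -
    have "(1 - w)\<^sup>2 - (1 - a)\<^sup>2 * inverse a * w = (1 - a * w) * (1 - w * inverse a)" for w
      using assms by (simp add: field_simps power2_eq_square)
    from this[of "z ^ r * (z ^ s) ^ j"] show ?thesis
      unfolding pair_factor_def power_add power_mult by (simp only: mult_ac)
  qed
  thus ?thesis
    by (simp add: qpoch_def prod.distrib)
qed

lemma num_sum_eq:
  fixes a z :: "'a::field"
  assumes a: "a \<noteq> 0" and nz: "\<And>j. j < M \<Longrightarrow> pair_factor 6 6 ((1 - a)\<^sup>2 * inverse a) z j \<noteq> 0"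
  shows "num_sum c z M ((1 - a)\<^sup>2 * inverse a) =
    (\<Prod>j<M. pair_factor 6 6 ((1 - a)\<^sup>2 * inverse a) z j) * (\<Sum>k\<le>M. c k * tpoch a z k)"
  unfolding num_sum_def sum_distrib_left
proof (rule sum.cong)
  fix k assume "k \<in> {..M}"
  define y where "y = (1 - a)\<^sup>2 * inverse a"
  have split: "(\<Prod>j<M. pair_factor 6 6 y z j) = (\<Prod>j<k. pair_factor 6 6 y z j) * (\<Prod>j\<in>{k..<M}. pair_factor 6 6 y z j)"
    using \<open>k \<in> {..M}\<close> by (subst prod.union_disjoint [symmetric]) (auto intro!: prod.cong)
  moreover have "(\<Prod>j<k. pair_factor 6 6 y z j) \<noteq> 0"
    using nz \<open>k \<in> {..M}\<close> by (auto simp: y_def)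
  moreover have "tpoch a z k = (\<Prod>j<k. pair_factor 1 2 y z j) / (\<Prod>j<k. pair_factor 6 6 y z j)"
    using prod_pair_factor[OF a, of 1 2 z k] prod_pair_factor[OF a, of 6 6 z k] by (simp add: y_def tpoch_def)
  ultimately show "c k * (\<Prod>j<k. pair_factor 1 2 y z j) * (\<Prod>j\<in>{k..<M}. pair_factor 6 6 y z j) =
      (\<Prod>j<M. pair_factor 6 6 y z j) * (c k * tpoch a z k)"
    by simp
qed simp

text \<open>Needed over two rings: the complex numbers, at a root of unity, and the power series
  around it.\<close>

lemma num_sum_poly:
  "\<exists>p. \<forall>y. poly p y = num_sum c z M y"
proof -
  define fp where "fp = (\<lambda>r s j. [:(1 - z ^ (r + s * j))\<^sup>2, - (z ^ (r + s * j)):])"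
  have "poly (\<Sum>k\<le>M. [:c k:] * (\<Prod>j<k. fp 1 2 j) * (\<Prod>j\<in>{k..<M}. fp 6 6 j)) y = num_sum c z M y" for y
    by (simp add: num_sum_def poly_sum poly_prod fp_def pair_factor_def mult.assoc)
  thus ?thesis by blast
qed

section \<open>The deformed sum as a cubic sum, over one period\<close>

definition qratio :: "'a::field \<Rightarrow> nat \<Rightarrow> 'a" where
  "qratio z j = qpoch z (z\<^sup>2) j / qpoch (z\<^sup>2) (z\<^sup>2) j"

text \<open>In base \<open>q = z^2\<close> with \<open>x = z\<close> and \<open>A = a z\<close>, one
  has \<open>x q^2 A = a z^6\<close> and \<open>x q^(4k) = z^(8k+1)\<close>, so the cubic summand is
  the deformed one.\<close>

lemma cubic_term_eq_tpoch:
  fixes z :: "'a::field"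
  assumes "a \<noteq> 0" "z \<noteq> 0"
  shows "cubic_term 0 (a * z) (z * inverse a) z (z\<^sup>2) k =
    qratio z (2 * k) * (1 - z ^ (8 * k + 1)) * z ^ (2 * k\<^sup>2) * tpoch a z k"
proof -
  have 1: "z * (z\<^sup>2)\<^sup>2 * (a * z) = a * z ^ 6" "z * (z\<^sup>2)\<^sup>2 * (z * inverse a) = z ^ 6 * inverse a"
    "(z\<^sup>2) ^ 3 = z ^ 6"
    by (simp_all add: eval_nat_numeral mult_ac)
  have 2: "z * ((z\<^sup>2) ^ (2 * k))\<^sup>2 = z ^ (8 * k + 1)" "(z\<^sup>2) ^ k\<^sup>2 = z ^ (2 * k\<^sup>2)"
    by (simp_all add: mult_ac flip: power_mult)
  show ?thesis
    unfolding cubic_term_def cubic_weight_def add_0_right mult_zero_left 1 2 qratio_def tpoch_def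
    by (simp only: times_divide_eq_left times_divide_eq_right times_divide_times_eq
        divide_divide_eq_left mult_ac)
qed

definition prim_root :: "complex \<Rightarrow> nat \<Rightarrow> bool" where
  "prim_root \<zeta> d \<longleftrightarrow> (\<forall>i. \<zeta> ^ i = 1 \<longleftrightarrow> d dvd i)"

lemma prim_root_norm:
  assumes "prim_root \<zeta> d" "d > 0"
  shows "norm \<zeta> = 1"
proof -
  have "\<zeta> ^ d = 1"
    using assms by (simp add: prim_root_def)
  thus ?thesis
    using assms(2) power_eq_1_iff by blast
qed

text \<open>The value of \<open>qratio \<zeta> (2 k)\<close>, with the factor \<open>1 - \<zeta>\<^sup>d\<close> cancelled up to the constant \<open>\<kappa>\<close>.\<close>

definition lim_coeff :: "complex \<Rightarrow> nat \<Rightarrow> complex \<Rightarrow> nat \<Rightarrow> complex" where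
  "lim_coeff \<zeta> d \<kappa> k =
     (if 2 * k < d then qratio \<zeta> (2 * k) else \<kappa> * qratio \<zeta> (2 * k - d))
       * (1 - \<zeta> ^ (8 * k + 1)) * \<zeta> ^ (2 * k\<^sup>2)"

text \<open>With \<open>d = 2 * M + 1\<close>, \<open>\<zeta>\<close> is the power of
  \<open>\<zeta>^2\<close> with exponent \<open>-M\<close>. So \<open>sum_cubic_x_eq_0\<close>
  applies in base \<open>\<zeta>^2\<close> with \<open>x = \<zeta>\<close>: to
  \<open>k \<le> M\<close> with \<open>e = 0\<close>, and to the remaining \<open>k\<close> with
  \<open>e = 1\<close>. Each part vanishes separately, for any \<open>\<kappa>\<close>.\<close>

lemma sum_lim_coeff:
  assumes \<zeta>: "prim_root \<zeta> d" and d: "coprime d 6" "d > 1"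
    and a: "norm a \<noteq> 1" "a \<noteq> 0"
  shows "(\<Sum>k\<le>d - 1. lim_coeff \<zeta> d \<kappa> k * tpoch a \<zeta> k) = 0"
proof -
  have n1: "norm \<zeta> = 1"
    using prim_root_norm[OF \<zeta>] d by simp
  hence z0: "\<zeta> \<noteq> 0" by auto
  have "odd d"
    using d(1) by (auto simp: coprime_def elim!: allE[of _ 2])
  then obtain M where M: "d = 2 * M + 1" by (elim oddE)
  have M1: "M \<ge> 1" using M d by simp
  have "\<not> 3 dvd d"
    using d(1) by (auto simp: coprime_def elim!: allE[of _ 3])
  \<comment> \<open>\<open>M mod 3 = 1\<close> would mean that 3 divides
    \<open>2 * M + 1\<close>.\<close>
  hence M3: "M mod 3 \<noteq> 1"
    unfolding M by presburger
  have zd: "\<zeta> ^ d = 1"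
    using \<zeta> by (simp add: prim_root_def)
  have "(\<zeta>\<^sup>2) ^ M * \<zeta> = 1"
    using zd unfolding M power_add power_mult by simp
  hence x: "inverse (\<zeta>\<^sup>2) ^ M = \<zeta>"
    by (simp add: power_inverse inverse_unique)
  have nzq: "(\<zeta>\<^sup>2) ^ i \<noteq> 1" if "0 < i" "i < d" for i
  proof
    assume "(\<zeta>\<^sup>2) ^ i = 1"
    hence "d dvd 2 * i"
      using \<zeta> by (simp add: prim_root_def flip: power_mult)
    moreover have "coprime d 2" using \<open>odd d\<close> by simp
    ultimately have "d dvd i" using coprime_dvd_mult_right_iff by blast
    with that show False by (auto dest: dvd_imp_le)
  qed
  have A: "(\<Sum>k\<le>M. lim_coeff \<zeta> d \<kappa> k * tpoch a \<zeta> k) = 0"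
  proof -
    have "(\<Sum>k\<le>M. cubic_term 0 (a * \<zeta>) (\<zeta> * inverse a) (inverse (\<zeta>\<^sup>2) ^ M) (\<zeta>\<^sup>2) k) = 0"
      using a nzq M3 M1 z0 by (intro sum_cubic_x_eq_0) (auto simp: norm_mult norm_power n1 M power2_eq_square)
    moreover have "lim_coeff \<zeta> d \<kappa> k * tpoch a \<zeta> k =
        cubic_term 0 (a * \<zeta>) (\<zeta> * inverse a) \<zeta> (\<zeta>\<^sup>2) k" if "k \<le> M" for k
      using that unfolding cubic_term_eq_tpoch[OF a(2) z0] lim_coeff_def by (simp add: M)
    ultimately show ?thesis
      unfolding x by simp
  qed
  \<comment> \<open>\<open>C\<close> collects what is independent of \<open>k\<close> in the second
    part. Exponents are reduced by \<open>\<zeta> ^ d = 1\<close>, and the index of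
    \<open>qratio\<close> becomes \<open>2 * k + 1\<close>, the shift by one half.\<close>
  define C where "C = \<kappa> * \<zeta> ^ (2 * (Suc M)\<^sup>2) * tpoch a \<zeta> (Suc M)"
  have B: "lim_coeff \<zeta> d \<kappa> (Suc M + k) * tpoch a \<zeta> (Suc M + k) =
      C * cubic_term 1 (a * \<zeta>\<^sup>2) (\<zeta>\<^sup>2 * inverse a) \<zeta> (\<zeta>\<^sup>2) k" for k
  proof -
    have e0: "2 * (Suc M + k) - d = 2 * k + 1" "\<not> 2 * (Suc M + k) < d"
      by (simp_all add: M)
    have e1: "\<zeta> ^ (8 * (Suc M + k) + 1) = \<zeta> * ((\<zeta>\<^sup>2) ^ (2 * k + 1))\<^sup>2"
    proof -
      have "8 * (Suc M + k) + 1 = 4 * d + (8 * k + 5)"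
        by (simp add: M)
      hence "\<zeta> ^ (8 * (Suc M + k) + 1) = (\<zeta> ^ d) ^ 4 * \<zeta> ^ (8 * k + 5)"
        by (simp only: power_add power_mult mult.commute[of 4])
      also have "\<dots> = \<zeta> ^ (8 * k + 5)" by (simp add: zd)
      also have "\<dots> = \<zeta> * ((\<zeta>\<^sup>2) ^ (2 * k + 1))\<^sup>2"
      proof -
        have "8 * k + 5 = Suc (2 * (2 * k + 1) * 2)" by simp
        thus ?thesis by (simp only: power_Suc power_mult)
      qed
      finally show ?thesis .
    qed
    have e2: "\<zeta> ^ (2 * (Suc M + k)\<^sup>2) = \<zeta> ^ (2 * (Suc M)\<^sup>2) * (\<zeta>\<^sup>2) ^ (k\<^sup>2 + 1 * k)"
    proof -
      have "2 * (Suc M + k)\<^sup>2 = 2 * (Suc M)\<^sup>2 + 2 * (k\<^sup>2 + 1 * k) + d * (2 * k)"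
        by (simp add: M power2_eq_square algebra_simps)
      thus ?thesis
        by (simp only: power_add power_mult zd power_one mult_1_right)
    qed
    have q1: "qpoch (b * \<zeta>) (\<zeta>\<^sup>2) (Suc M + k) = qpoch (b * \<zeta>) (\<zeta>\<^sup>2) (Suc M) * qpoch (b * \<zeta>\<^sup>2) (\<zeta>\<^sup>2) k" for b
    proof -
      have "b * \<zeta> * (\<zeta>\<^sup>2) ^ Suc M = b * \<zeta>\<^sup>2 * \<zeta> ^ d"
        by (simp add: M power_mult power2_eq_square)
      thus ?thesis by (simp only: qpoch_add zd mult_1_right)
    qed
    have q2: "qpoch (b * \<zeta> ^ 6) (\<zeta> ^ 6) (Suc M + k) = qpoch (b * \<zeta> ^ 6) (\<zeta> ^ 6) (Suc M) *
        qpoch (\<zeta> * (\<zeta>\<^sup>2) ^ (2 + 1) * (b * \<zeta>\<^sup>2)) ((\<zeta>\<^sup>2) ^ 3) k" for b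
    proof -
      have "b * \<zeta> ^ 6 * (\<zeta> ^ 6) ^ Suc M = b * \<zeta> ^ 9 * (\<zeta> ^ d) ^ 3"
        by (simp add: M flip: power_mult) (simp add: power_add algebra_simps eval_nat_numeral)
      moreover have "\<zeta> * (\<zeta>\<^sup>2) ^ (2 + 1) * (b * \<zeta>\<^sup>2) = b * \<zeta> ^ 9" "(\<zeta>\<^sup>2) ^ 3 = \<zeta> ^ 6"
        by (simp_all add: eval_nat_numeral mult_ac)
      ultimately show ?thesis by (simp only: qpoch_add zd mult_1_right power_one)
    qed
    show ?thesis
      unfolding lim_coeff_def if_not_P[OF e0(2)] e0(1) e1 e2 tpoch_def C_def cubic_term_def cubic_weight_def qratio_def q1 q2
        mult.commute[of _ "inverse a"]
      by (simp only: times_divide_eq_left times_divide_eq_right times_divide_times_eq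
        divide_divide_eq_left mult_ac)
  qed
  have "(\<Sum>k\<le>M - 1. cubic_term 1 (a * \<zeta>\<^sup>2) (\<zeta>\<^sup>2 * inverse a) (inverse (\<zeta>\<^sup>2) ^ M) (\<zeta>\<^sup>2) k) = 0"
    using a nzq M3 M1 z0
    by (intro sum_cubic_x_eq_0) (auto simp: norm_mult norm_power n1 M power2_eq_square)
  hence "(\<Sum>k\<le>M - 1. lim_coeff \<zeta> d \<kappa> (Suc M + k) * tpoch a \<zeta> (Suc M + k)) = 0"
    unfolding B x by (simp flip: sum_distrib_left)
  moreover have U: "{..d - 1} = {..M} \<union> (\<lambda>k. Suc M + k) ` {..M - 1}"
  proof safe
    fix k assume "k \<le> d - 1" "k \<notin> (\<lambda>k. Suc M + k) ` {..M - 1}"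
    show "k \<le> M"
    proof (rule ccontr)
      assume "\<not> k \<le> M"
      hence "k = Suc M + (k - Suc M)" "k - Suc M \<in> {..M - 1}"
        using \<open>k \<le> d - 1\<close> M by auto
      with \<open>k \<notin> _\<close> show False by blast
    qed
  qed (use M M1 in auto)
  have "(\<Sum>k\<le>d - 1. lim_coeff \<zeta> d \<kappa> k * tpoch a \<zeta> k) =
      (\<Sum>k\<le>M. lim_coeff \<zeta> d \<kappa> k * tpoch a \<zeta> k) +
      (\<Sum>k\<le>M - 1. lim_coeff \<zeta> d \<kappa> (Suc M + k) * tpoch a \<zeta> (Suc M + k))"
    unfolding U by (subst sum.union_disjoint) (auto simp: sum.reindex inj_on_def)
  ultimately show ?thesis using A by simp
qed

text \<open>A polynomial in \<open>y\<close> that vanishes for infinitely many \<open>a\<close> of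
  norm other than 1 vanishes identically. This reaches \<open>y = 0\<close>, that is
  \<open>a = 1\<close>, where the norm argument for the denominators fails.\<close>

lemma num_sum_lim_coeff_eq_0:
  assumes \<zeta>: "prim_root \<zeta> d" and d: "coprime d 6" "d > 1"
  shows "num_sum (lim_coeff \<zeta> d \<kappa>) \<zeta> (d - 1) y = 0"
proof -
  \<comment> \<open>The values of \<open>y\<close> at the integers \<open>a = m + 2\<close>. They
    are distinct, because equal values at \<open>A\<close> and \<open>B\<close> force
    \<open>A = B\<close> or \<open>A * B = 1\<close>.\<close>
  define f where "f = (\<lambda>m::nat. (1 - of_nat (m + 2))\<^sup>2 * inverse (of_nat (m + 2)) :: complex)"
  obtain p where p: "\<And>y. poly p y = num_sum (lim_coeff \<zeta> d \<kappa>) \<zeta> (d - 1) y"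
    using num_sum_poly by blast
  have n1: "norm \<zeta> = 1"
    using prim_root_norm[OF \<zeta>] d by simp
  have "poly p (f m) = 0" for m
  proof -
    define a where "a = (of_nat (m + 2) :: complex)"
    have na: "norm a = real (m + 2)"
      unfolding a_def norm_of_nat ..
    hence a: "norm a \<noteq> 1" "a \<noteq> 0" by auto
    have "pair_factor 6 6 ((1 - a)\<^sup>2 * inverse a) \<zeta> j \<noteq> 0" for j
    proof -
      define w where "w = \<zeta> ^ (6 + 6 * j)"
      have w: "norm w = 1" by (simp add: w_def norm_power n1)
      have "pair_factor 6 6 ((1 - a)\<^sup>2 * inverse a) \<zeta> j = (1 - a * w) * (1 - w * inverse a)"
        using a unfolding pair_factor_def w_def [symmetric] by (simp add: field_simps power2_eq_square)
      moreover have "norm (a * w) \<noteq> 1" "norm (w * inverse a) \<noteq> 1"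
        using na by (simp_all add: norm_mult norm_inverse w)
      hence "a * w \<noteq> 1" "w * inverse a \<noteq> 1" by auto
      ultimately show ?thesis by simp
    qed
    from num_sum_eq[OF a(2) this] sum_lim_coeff[OF \<zeta> d a] show ?thesis
      by (simp add: p f_def a_def)
  qed
  moreover have "inj f"
  proof (rule injI)
    fix m n assume mn: "f m = f n"
    define A B where "A = real (m + 2)" and "B = real (n + 2)"
    have AB: "A \<ge> 2" "B \<ge> 2" by (simp_all add: A_def B_def)
    have "f m = of_real ((1 - A)\<^sup>2 * inverse A)" "f n = of_real ((1 - B)\<^sup>2 * inverse B)"
      by (simp_all add: f_def A_def B_def)
    with mn have "(1 - A)\<^sup>2 * inverse A = (1 - B)\<^sup>2 * inverse B"
      by (simp only: of_real_eq_iff)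
    hence "(A - B) * (A * B - 1) = 0"
      using AB by (simp add: field_simps power2_eq_square)
    moreover have "A * B \<ge> 2 * 2"
      using AB by (intro mult_mono) auto
    ultimately show "m = n" by (auto simp: A_def B_def)
  qed
  hence "infinite (range f)"
    by (simp add: finite_image_iff)
  moreover have "range f \<subseteq> {x. poly p x = 0}"
    using \<open>\<And>m. poly p (f m) = 0\<close> by auto
  ultimately have "infinite {x. poly p x = 0}"
    using finite_subset by blast
  hence "p = 0"
    using poly_roots_finite by blast
  with p show ?thesis by (metis poly_0)
qed

subsection \<open>Local behaviour near a root of unity\<close>

text \<open>Regular with value \<open>c\<close> at the centre of expansion. Laurent series form a
  field, so quotients whose numerator and denominator both vanish there can be written down.\<close>

definition has_value :: "complex fls \<Rightarrow> complex \<Rightarrow> bool" where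
  "has_value f c \<longleftrightarrow> (\<exists>g. f = fps_to_fls g \<and> fps_nth g 0 = c)"

lemma has_valueE: "has_value f c \<Longrightarrow> (\<And>g. f = fps_to_fls g \<Longrightarrow> fps_nth g 0 = c \<Longrightarrow> P) \<Longrightarrow> P"
  by (auto simp: has_value_def)

lemma has_valueI: "f = fps_to_fls g \<Longrightarrow> fps_nth g 0 = c \<Longrightarrow> has_value f c"
  by (auto simp: has_value_def)

lemma has_value_1: "has_value 1 1"
  by (rule has_valueI[of _ 1]) auto

lemma has_value_0: "has_value 0 0"
  by (rule has_valueI[of _ 0]) auto

lemma has_value_diff: "has_value f a \<Longrightarrow> has_value g b \<Longrightarrow> has_value (f - g) (a - b)"
  by (elim has_valueE) (rule has_valueI, rule fps_to_fls_minus [symmetric, THEN trans[rotated]], auto)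

lemma has_value_add: "has_value f a \<Longrightarrow> has_value g b \<Longrightarrow> has_value (f + g) (a + b)"
  by (elim has_valueE) (rule has_valueI, rule fps_to_fls_plus [symmetric, THEN trans[rotated]], auto)

lemma has_value_mult: "has_value f a \<Longrightarrow> has_value g b \<Longrightarrow> has_value (f * g) (a * b)"
  unfolding has_value_def by (metis fls_times_fps_to_fls fps_mult_nth_0)

lemma fps_to_fls_inverse:
  "fps_nth (f :: complex fps) 0 \<noteq> 0 \<Longrightarrow> fps_to_fls (inverse f) = inverse (fps_to_fls f)"
  by (subst fls_inverse_fps_to_fls) (auto simp: subdegree_eq_0_iff)

lemma has_value_inverse: "has_value f a \<Longrightarrow> a \<noteq> 0 \<Longrightarrow> has_value (inverse f) (inverse a)"
  by (elim has_valueE) (rule has_valueI, rule fps_to_fls_inverse [symmetric, THEN trans[rotated]], auto)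

lemma has_value_divide: "has_value f a \<Longrightarrow> has_value g b \<Longrightarrow> b \<noteq> 0 \<Longrightarrow> has_value (f / g) (a / b)"
  unfolding divide_inverse by (intro has_value_mult has_value_inverse)

lemma has_value_power: "has_value f a \<Longrightarrow> has_value (f ^ n) (a ^ n)"
  by (induction n) (auto intro: has_value_mult has_value_1)

lemma has_value_prod: "(\<And>x. x \<in> A \<Longrightarrow> has_value (f x) (g x)) \<Longrightarrow> has_value (prod f A) (prod g A)"
  by (induction A rule: infinite_finite_induct) (auto intro: has_value_mult has_value_1)

lemma has_value_sum: "(\<And>x. x \<in> A \<Longrightarrow> has_value (f x) (g x)) \<Longrightarrow> has_value (sum f A) (sum g A)"
  by (induction A rule: infinite_finite_induct) (auto intro: has_value_add has_value_0)

lemma has_value_qpoch: "has_value f a \<Longrightarrow> has_value g b \<Longrightarrow> has_value (qpoch f g k) (qpoch a b k)"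
  unfolding qpoch_def by (intro has_value_prod has_value_diff has_value_mult has_value_power has_value_1)

section \<open>Expansion of q at a primitive root of unity\<close>

definition shifted_var :: "complex \<Rightarrow> complex fps" where
  "shifted_var \<zeta> = fps_const \<zeta> + fps_X"

lemma shifted_var_nth_0 [simp]: "fps_nth (shifted_var \<zeta>) 0 = \<zeta>"
  by (simp add: shifted_var_def)

lemma shifted_var_power_neq_1:
  assumes "i > 0"
  shows "shifted_var \<zeta> ^ i \<noteq> 1"
proof
  assume "shifted_var \<zeta> ^ i = 1"
  hence "fps_deriv (shifted_var \<zeta> ^ i) = 0" by simp
  moreover have "shifted_var \<zeta> \<noteq> 0"
    by (auto simp: shifted_var_def fps_eq_iff intro!: exI[of _ 1])
  ultimately show False
    using assms by (simp add: fps_deriv_power shifted_var_def)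
qed

locale primitive_root =
  fixes \<zeta> :: complex and d :: nat
  assumes prim: "prim_root \<zeta> d" and d6: "coprime d 6" and d1: "d > 1"
begin

definition Z :: "complex fls" where "Z = fps_to_fls (shifted_var \<zeta>)"

lemma \<zeta>_power_eq_1_iff: "\<zeta> ^ i = 1 \<longleftrightarrow> d dvd i"
  using prim by (simp add: prim_root_def)

lemma \<zeta>_nz: "\<zeta> \<noteq> 0"
  using prim_root_norm[OF prim] d1 by auto

lemma has_value_Z: "has_value Z \<zeta>"
  unfolding Z_def by (rule has_valueI) auto

lemma Z_power_neq_1: "i > 0 \<Longrightarrow> Z ^ i \<noteq> 1"
  using shifted_var_power_neq_1[of i \<zeta>] by (simp add: Z_def flip: fps_to_fls_power)

lemma Z_nz: "Z \<noteq> 0"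
  using Z_power_neq_1[of 1] \<zeta>_nz has_value_Z by (auto simp: has_value_def)

lemma coprime_2_d: "coprime 2 d" and odd_d: "odd d"
  using d6 by (auto simp: coprime_commute intro: coprime_divisors[of 2 6 d d])
lemma coprime_6_d: "coprime 6 d"
  using d6 by (simp add: coprime_commute)

text \<open>The reference zero at \<open>\<zeta>\<close>: a factor \<open>1 - Z ^ i\<close> with
  \<open>d dvd i\<close> is \<open>w\<close> times a geometric sum with value
  \<open>i div d\<close>.\<close>

definition w :: "complex fls" where "w = 1 - Z ^ d"

lemma w_nz: "w \<noteq> 0"
  using Z_power_neq_1[of d] d1 by (simp add: w_def)

lemma has_value_one_minus: "has_value (1 - Z ^ i) (1 - \<zeta> ^ i)"
  by (intro has_value_diff has_value_1 has_value_power has_value_Z)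

lemma has_value_one_minus_div:
  assumes "d dvd i"
  shows "has_value ((1 - Z ^ i) / w) (of_nat (i div d))"
proof -
  from assms obtain s where s: "i = d * s" by auto
  have "(1 - Z ^ i) / w = (\<Sum>j<s. (Z ^ d) ^ j)"
    using w_nz one_diff_power_eq[of "Z ^ d" s] by (simp add: s w_def power_mult)
  moreover have "has_value (\<Sum>j<s. (Z ^ d) ^ j) (\<Sum>j<s. (\<zeta> ^ d) ^ j)"
    by (intro has_value_sum has_value_power has_value_Z)
  ultimately show ?thesis
    using d1 \<zeta>_power_eq_1_iff[of d] by (simp add: s)
qed

text \<open>As \<open>s\<close> is invertible modulo \<open>d\<close>, exactly one of the
  \<open>d\<close> exponents \<open>r + s * j\<close> is divisible by \<open>d\<close>; the other
  factors are nonzero at \<open>\<zeta>\<close>. So a block of \<open>d\<close> factors vanishes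
  exactly like \<open>w\<close>.\<close>

lemma has_value_qpoch_block:
  assumes r: "r > 0" and s: "coprime s d"
  shows "\<exists>c. c \<noteq> 0 \<and> has_value (qpoch (Z ^ r) (Z ^ s) d / w) c"
proof -
  obtain x where x: "[s * x = 1] (mod d)"
    using cong_solve_coprime_nat[OF s] by auto
  \<comment> \<open>The solution of \<open>r + s * j = 0\<close> modulo \<open>d\<close>, with
    \<open>d - r mod d\<close> in the place of \<open>-r\<close>.\<close>
  define j0 where "j0 = (x * (d - r mod d)) mod d"
  have "[r + s * j0 = r + s * (x * (d - r mod d))] (mod d)"
    unfolding j0_def by (intro cong_add cong_mult cong_refl) (simp add: cong_mod_left)
  also have "r + s * (x * (d - r mod d)) = r + (s * x) * (d - r mod d)"
    by simp
  also have "[\<dots> = r mod d + 1 * (d - r mod d)] (mod d)"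
    by (intro cong_add cong_mult x cong_refl) (simp add: cong_mod_right)
  also have "r mod d + 1 * (d - r mod d) = d"
    using d1 by (simp add: less_imp_le)
  finally have j0: "d dvd r + s * j0"
    by (simp add: unique_euclidean_semiring_class.cong_def dvd_eq_mod_eq_0)
  have j0d: "j0 < d" using d1 by (simp add: j0_def)
  have other: "\<not> d dvd r + s * j" if "j < d" "j \<noteq> j0" for j
  proof
    assume "d dvd r + s * j"
    hence "[r + s * j = r + s * j0] (mod d)"
      using j0 by (simp add: unique_euclidean_semiring_class.cong_def dvd_eq_mod_eq_0)
    hence "[s * j = s * j0] (mod d)"
      by (simp add: cong_add_lcancel_nat)
    hence "[j = j0] (mod d)"
      using s by (simp add: cong_mult_lcancel_nat)
    with that j0d show False
      by (simp add: unique_euclidean_semiring_class.cong_def)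
  qed
  have "qpoch (Z ^ r) (Z ^ s) d = (\<Prod>j<d. 1 - Z ^ (r + s * j))"
    by (simp add: qpoch_def power_add power_mult)
  also have "\<dots> = (1 - Z ^ (r + s * j0)) * (\<Prod>j\<in>{..<d} - {j0}. 1 - Z ^ (r + s * j))"
    using j0d by (intro prod.remove) auto
  finally have eq: "qpoch (Z ^ r) (Z ^ s) d / w =
      (1 - Z ^ (r + s * j0)) / w * (\<Prod>j\<in>{..<d} - {j0}. 1 - Z ^ (r + s * j))"
    by simp
  have "has_value (qpoch (Z ^ r) (Z ^ s) d / w)
      (of_nat ((r + s * j0) div d) * (\<Prod>j\<in>{..<d} - {j0}. 1 - \<zeta> ^ (r + s * j)))"
    unfolding eq by (intro has_value_mult has_value_prod has_value_one_minus has_value_one_minus_div j0)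
  moreover have "(r + s * j0) div d \<noteq> 0"
    using j0 r by (metis add_is_0 dvd_div_eq_0_iff less_not_refl)
  moreover have "(\<Prod>j\<in>{..<d} - {j0}. 1 - \<zeta> ^ (r + s * j)) \<noteq> 0"
    using other \<zeta>_power_eq_1_iff by auto
  ultimately show ?thesis
    by (intro exI conjI) auto
qed

lemma has_value_qpoch_blocks:
  assumes r: "r > 0" and s: "coprime s d"
  shows "\<exists>c. c \<noteq> 0 \<and> has_value (qpoch (Z ^ r) (Z ^ s) (l * d) / w ^ l) c"
proof (induction l)
  case 0
  show ?case by (rule exI[of _ 1]) (auto intro: has_value_1)
next
  case (Suc l)
  then obtain c where c: "c \<noteq> 0" "has_value (qpoch (Z ^ r) (Z ^ s) (l * d) / w ^ l) c" by auto
  have "r + s * (l * d) > 0" using r by simp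
  from has_value_qpoch_block[OF this s] obtain c' where
    c': "c' \<noteq> 0" "has_value (qpoch (Z ^ (r + s * (l * d))) (Z ^ s) d / w) c'" by auto
  have "qpoch (Z ^ r) (Z ^ s) (Suc l * d) =
      qpoch (Z ^ r) (Z ^ s) (l * d) * qpoch (Z ^ (r + s * (l * d))) (Z ^ s) d"
    using qpoch_add[of "Z ^ r" "Z ^ s" "l * d" d] by (simp add: power_add power_mult add.commute)
  hence "qpoch (Z ^ r) (Z ^ s) (Suc l * d) / w ^ Suc l =
      qpoch (Z ^ r) (Z ^ s) (l * d) / w ^ l * (qpoch (Z ^ (r + s * (l * d))) (Z ^ s) d / w)"
    by simp
  with has_value_mult[OF c(2) c'(2)] c(1) c'(1) show ?case
    by (intro exI[of _ "c * c'"]) simp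
qed

text \<open>Over \<open>l\<close> full periods numerator and denominator both contain
  \<open>w ^ l\<close>, which cancels. The remaining constant \<open>c\<close> does not depend on
  the incomplete period \<open>i\<close>; this uniformity lets it be pulled out of sums over
  \<open>i\<close>.\<close>

lemma has_value_qpoch_ratio:
  assumes "r > 0" "coprime s d" "r' > 0" "coprime s' d"
  shows "\<exists>c. (l = 0 \<longrightarrow> c = 1) \<and> (\<forall>i. qpoch (\<zeta> ^ r') (\<zeta> ^ s') i \<noteq> 0 \<longrightarrow>
    has_value (qpoch (Z ^ r) (Z ^ s) (l * d + i) / qpoch (Z ^ r') (Z ^ s') (l * d + i))
      (c * (qpoch (\<zeta> ^ r) (\<zeta> ^ s) i / qpoch (\<zeta> ^ r') (\<zeta> ^ s') i)))"
proof -
  define c where "c = (\<lambda>r s. SOME c. c \<noteq> 0 \<and> has_value (qpoch (Z ^ r) (Z ^ s) (l * d) / w ^ l) c)"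
  have c: "c r s \<noteq> 0 \<and> has_value (qpoch (Z ^ r) (Z ^ s) (l * d) / w ^ l) (c r s)"
    if "r > 0" "coprime s d" for r s
    unfolding c_def by (rule someI_ex, rule has_value_qpoch_blocks[OF that])
  have tail: "has_value (qpoch (Z ^ (r + s * (l * d))) (Z ^ s) i) (qpoch (\<zeta> ^ r) (\<zeta> ^ s) i)" for r s i
  proof -
    have "\<zeta> ^ (r + s * (l * d)) = \<zeta> ^ r"
      using \<zeta>_power_eq_1_iff[of "s * (l * d)"] by (simp add: power_add)
    with has_value_qpoch[OF has_value_power[OF has_value_Z, of "r + s * (l * d)"] has_value_power[OF has_value_Z, of s], of i]
    show ?thesis by simp
  qed
  have split: "qpoch (Z ^ r) (Z ^ s) (l * d + i) =
      w ^ l * (qpoch (Z ^ r) (Z ^ s) (l * d) / w ^ l * qpoch (Z ^ (r + s * (l * d))) (Z ^ s) i)" for r s i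
    using w_nz by (simp add: qpoch_add power_add power_mult)
  have 0: "c r s = 1" if "l = 0" "r > 0" "coprime s d" for r s
    using c[OF that(2,3)] that(1) by (auto simp: has_value_def)
  show ?thesis
  proof (intro exI[of _ "c r s / c r' s'"] conjI allI impI)
    show "c r s / c r' s' = 1" if "l = 0"
      using 0 that assms by simp
  next
    fix i assume nz: "qpoch (\<zeta> ^ r') (\<zeta> ^ s') i \<noteq> 0"
    have 1: "has_value ((qpoch (Z ^ r) (Z ^ s) (l * d) / w ^ l * qpoch (Z ^ (r + s * (l * d))) (Z ^ s) i) /
        (qpoch (Z ^ r') (Z ^ s') (l * d) / w ^ l * qpoch (Z ^ (r' + s' * (l * d))) (Z ^ s') i))
        ((c r s * qpoch (\<zeta> ^ r) (\<zeta> ^ s) i) / (c r' s' * qpoch (\<zeta> ^ r') (\<zeta> ^ s') i))"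
      using c assms nz by (intro has_value_divide has_value_mult tail) auto
    have 2: "(c r s * qpoch (\<zeta> ^ r) (\<zeta> ^ s) i) / (c r' s' * qpoch (\<zeta> ^ r') (\<zeta> ^ s') i) =
        c r s / c r' s' * (qpoch (\<zeta> ^ r) (\<zeta> ^ s) i / qpoch (\<zeta> ^ r') (\<zeta> ^ s') i)"
      by simp
    have 3: "(w ^ l * x) / (w ^ l * y) = x / y" for x y
      using w_nz by simp
    show "has_value (qpoch (Z ^ r) (Z ^ s) (l * d + i) / qpoch (Z ^ r') (Z ^ s') (l * d + i))
        (c r s / c r' s' * (qpoch (\<zeta> ^ r) (\<zeta> ^ s) i / qpoch (\<zeta> ^ r') (\<zeta> ^ s') i))"
      unfolding split 3 using 1 unfolding 2 .
  qed
qed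


text \<open>The part of the summand free of \<open>a\<close>, multiplied by
  \<open>1 - q\<close>.\<close>

definition sum_coeff :: "nat \<Rightarrow> complex fls" where
  "sum_coeff k = qratio Z (2 * k) * (1 - Z ^ (8 * k + 1)) * Z ^ (2 * k\<^sup>2)"

lemma qpoch_\<zeta>_nz:
  assumes "coprime s d" "i < d"
  shows "qpoch (\<zeta> ^ s) (\<zeta> ^ s) i \<noteq> 0"
proof -
  have "\<zeta> ^ s * (\<zeta> ^ s) ^ j \<noteq> 1" if "j < i" for j
  proof
    assume "\<zeta> ^ s * (\<zeta> ^ s) ^ j = 1"
    hence "d dvd s * Suc j"
      by (simp only: power_mult power_Suc flip: \<zeta>_power_eq_1_iff)
    hence "d dvd Suc j"
      using assms(1) by (metis coprime_commute coprime_dvd_mult_right_iff)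
    thus False using that assms(2) by (auto dest: dvd_imp_le)
  qed
  thus ?thesis by (auto simp: qpoch_eq_0_iff)
qed

lemma has_value_qratio:
  "\<exists>c. (l = 0 \<longrightarrow> c = 1) \<and> (\<forall>i<d. has_value (qratio Z (l * d + i)) (c * qratio \<zeta> i))"
proof -
  obtain c where c: "l = 0 \<longrightarrow> c = 1" "\<And>i. qpoch (\<zeta> ^ 2) (\<zeta> ^ 2) i \<noteq> 0 \<Longrightarrow>
    has_value (qpoch (Z ^ 1) (Z ^ 2) (l * d + i) / qpoch (Z ^ 2) (Z ^ 2) (l * d + i))
      (c * (qpoch (\<zeta> ^ 1) (\<zeta> ^ 2) i / qpoch (\<zeta> ^ 2) (\<zeta> ^ 2) i))"
    using has_value_qpoch_ratio[of 1 2 2 2 l] coprime_2_d by auto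
  have "has_value (qratio Z (l * d + i)) (c * qratio \<zeta> i)" if "i < d" for i
    using c(2)[OF qpoch_\<zeta>_nz[OF coprime_2_d that]] by (simp add: qratio_def)
  with c(1) show ?thesis by blast
qed

text \<open>For \<open>k < d\<close> the index \<open>2 * k\<close> lies in the first or second
  period of \<open>qratio\<close>; \<open>\<kappa>\<close> is the constant of the second.\<close>

lemma has_value_sum_coeff: "\<exists>\<kappa>. \<forall>k<d. has_value (sum_coeff k) (lim_coeff \<zeta> d \<kappa> k)"
proof -
  obtain \<kappa> where \<kappa>: "\<And>i. i < d \<Longrightarrow> has_value (qratio Z (1 * d + i)) (\<kappa> * qratio \<zeta> i)"
    using has_value_qratio[of 1] by blast
  have lo: "has_value (qratio Z i) (qratio \<zeta> i)" if "i < d" for i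
    using has_value_qratio[of 0] that by auto
  have "has_value (sum_coeff k) (lim_coeff \<zeta> d \<kappa> k)" if "k < d" for k
  proof -
    have "has_value (qratio Z (2 * k)) (if 2 * k < d then qratio \<zeta> (2 * k) else \<kappa> * qratio \<zeta> (2 * k - d))"
      using lo[of "2 * k"] \<kappa>[of "2 * k - d"] that by (cases "2 * k < d") auto
    thus ?thesis
      unfolding sum_coeff_def lim_coeff_def by (intro has_value_mult has_value_one_minus has_value_power has_value_Z)
  qed
  thus ?thesis by blast
qed

lemma tpoch_1: "tpoch 1 z k = (qpoch z (z\<^sup>2) k / qpoch (z ^ 6) (z ^ 6) k)\<^sup>2"
  for z :: "'a::field"
  by (simp add: tpoch_def power2_eq_square)

text \<open>The case \<open>y = 0\<close> of the polynomial identity. The denominator can be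
  restored since \<open>d\<close> does not divide \<open>6 * Suc j\<close> for
  \<open>j < d - 1\<close>.\<close>

lemma sum_lim_coeff_1: "(\<Sum>k<d. lim_coeff \<zeta> d \<kappa> k * tpoch 1 \<zeta> k) = 0"
proof -
  have pair_factor: "pair_factor 6 6 0 \<zeta> j \<noteq> 0" if "j < d - 1" for j
  proof -
    have "\<not> d dvd 6 * Suc j"
      using that coprime_6_d by (metis coprime_commute coprime_dvd_mult_right_iff dvd_imp_le less_diff_conv
          not_less plus_1_eq_Suc add.commute zero_less_Suc)
    hence "\<zeta> ^ (6 + 6 * j) \<noteq> 1"
      using \<zeta>_power_eq_1_iff[of "6 + 6 * j"] by simp
    thus ?thesis by (simp add: pair_factor_def)
  qed
  have "num_sum (lim_coeff \<zeta> d \<kappa>) \<zeta> (d - 1) ((1 - 1)\<^sup>2 * inverse 1) =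
      (\<Prod>j<d - 1. pair_factor 6 6 ((1 - 1)\<^sup>2 * inverse 1) \<zeta> j) * (\<Sum>k\<le>d - 1. lim_coeff \<zeta> d \<kappa> k * tpoch 1 \<zeta> k)"
    using pair_factor by (intro num_sum_eq) auto
  hence "(\<Prod>j<d - 1. pair_factor 6 6 0 \<zeta> j) * (\<Sum>k\<le>d - 1. lim_coeff \<zeta> d \<kappa> k * tpoch 1 \<zeta> k) = 0"
    using num_sum_lim_coeff_eq_0[OF prim d6 d1, of \<kappa> 0] by simp
  moreover have "(\<Prod>j<d - 1. pair_factor 6 6 0 \<zeta> j) \<noteq> 0"
    using pair_factor by simp
  moreover have "{..d - 1} = {..<d}" using d1 by auto
  ultimately show ?thesis by simp
qed

text \<open>At \<open>\<zeta>\<close> the block is a constant multiple of the sum over one period.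
  Its two halves could carry different constants \<open>c1\<close> and \<open>c2\<close>, but
  \<open>tpoch 1 \<zeta> i\<close> vanishes in the second half, so \<open>\<kappa>\<close> is
  arbitrary and set to 1.\<close>

lemma has_value_block_sum: "has_value (\<Sum>i<d. sum_coeff (l * d + i) * tpoch 1 Z (l * d + i)) 0"
proof -
  obtain c1 where c1: "\<And>i. i < d \<Longrightarrow> has_value (qratio Z (2 * l * d + i)) (c1 * qratio \<zeta> i)"
    using has_value_qratio[of "2 * l"] by blast
  obtain c2 where c2: "\<And>i. i < d \<Longrightarrow> has_value (qratio Z ((2 * l + 1) * d + i)) (c2 * qratio \<zeta> i)"
    using has_value_qratio[of "2 * l + 1"] by blast
  obtain c3 where c3: "\<And>i. qpoch (\<zeta> ^ 6) (\<zeta> ^ 6) i \<noteq> 0 \<Longrightarrow>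
    has_value (qpoch (Z ^ 1) (Z ^ 2) (l * d + i) / qpoch (Z ^ 6) (Z ^ 6) (l * d + i))
      (c3 * (qpoch (\<zeta> ^ 1) (\<zeta> ^ 2) i / qpoch (\<zeta> ^ 6) (\<zeta> ^ 6) i))"
    using has_value_qpoch_ratio[of 1 2 6 6 l] coprime_2_d coprime_6_d by auto
  have "has_value (sum_coeff (l * d + i) * tpoch 1 Z (l * d + i)) (c1 * c3\<^sup>2 * (lim_coeff \<zeta> d 1 i * tpoch 1 \<zeta> i))"
    if i: "i < d" for i
  proof -
    have t: "has_value (tpoch 1 Z (l * d + i)) (c3\<^sup>2 * tpoch 1 \<zeta> i)"
      using has_value_power[OF c3[OF qpoch_\<zeta>_nz[OF coprime_6_d i]], of 2]
      by (simp add: tpoch_1 power_mult_distrib power_divide)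
    have e8: "\<zeta> ^ (8 * (l * d + i) + 1) = \<zeta> ^ (8 * i + 1)"
      using \<zeta>_power_eq_1_iff[of "8 * (l * d)"] by (simp add: power_add distrib_left)
    have e2: "\<zeta> ^ (2 * (l * d + i)\<^sup>2) = \<zeta> ^ (2 * i\<^sup>2)"
    proof -
      have "2 * (l * d + i)\<^sup>2 = d * (2 * l * (l * d + 2 * i)) + 2 * i\<^sup>2"
        by (simp add: power2_eq_square algebra_simps)
      thus ?thesis
        using \<zeta>_power_eq_1_iff[of "d * (2 * l * (l * d + 2 * i))"] by (simp add: power_add)
    qed
    have sum_coeff: "has_value (sum_coeff (l * d + i)) (x * (1 - \<zeta> ^ (8 * i + 1)) * \<zeta> ^ (2 * i\<^sup>2))"
      if "has_value (qratio Z (2 * (l * d + i))) x" for x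
      using has_value_mult[OF has_value_mult[OF that has_value_one_minus[of "8 * (l * d + i) + 1"]]
        has_value_power[OF has_value_Z, of "2 * (l * d + i)\<^sup>2"]]
      unfolding sum_coeff_def e8 e2 .
    show ?thesis
    proof (cases "2 * i < d")
      case True
      have "2 * (l * d + i) = 2 * l * d + 2 * i" by simp
      with c1[OF True] have "has_value (qratio Z (2 * (l * d + i))) (c1 * qratio \<zeta> (2 * i))"
        by metis
      from has_value_mult[OF sum_coeff[OF this] t] show ?thesis
        using True by (simp add: lim_coeff_def mult_ac)
    next
      case False
      have "2 * (l * d + i) = (2 * l + 1) * d + (2 * i - d)" "2 * i - d < d"
        using False i by (simp_all add: algebra_simps)
      with c2[of "2 * i - d"] have "has_value (qratio Z (2 * (l * d + i))) (c2 * qratio \<zeta> (2 * i - d))"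
        by metis
      \<comment> \<open>The factor with index \<open>M\<close> of the numerator symbol is
        \<open>1 - \<zeta> ^ d\<close>, and it is present as soon as
        \<open>2 * i \<ge> d\<close>.\<close>
      moreover have "tpoch 1 \<zeta> i = 0"
      proof -
        obtain M where M: "d = 2 * M + 1" using odd_d by (elim oddE)
        have "\<zeta> * (\<zeta>\<^sup>2) ^ M = 1"
          using \<zeta>_power_eq_1_iff[of d] by (simp add: M power_mult)
        moreover have "M < i" using False M by simp
        ultimately have "qpoch \<zeta> (\<zeta>\<^sup>2) i = 0"
          by (auto simp: qpoch_eq_0_iff)
        thus ?thesis by (simp add: tpoch_1)
      qed
      ultimately show ?thesis
        using has_value_mult[OF sum_coeff t] by fastforce
    qed
  qed
  hence "has_value (\<Sum>i<d. sum_coeff (l * d + i) * tpoch 1 Z (l * d + i))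
      (\<Sum>i<d. c1 * c3\<^sup>2 * (lim_coeff \<zeta> d 1 i * tpoch 1 \<zeta> i))"
    by (intro has_value_sum) auto
  thus ?thesis
    by (simp add: sum_lim_coeff_1 flip: sum_distrib_left)
qed

lemma has_value_sum_multiple: "has_value (\<Sum>k<m * d. sum_coeff k * tpoch 1 Z k) 0"
proof (induction m)
  case 0
  show ?case by (simp add: has_value_0)
next
  case (Suc m)
  have "(\<Sum>k<a + b. f k) = (\<Sum>k<a. f k) + (\<Sum>i<b. f (a + i))" for a b and f :: "nat \<Rightarrow> complex fls"
    by (induction b) (simp_all add: add.assoc)
  from this[of _ "m * d" d] has_value_add[OF Suc has_value_block_sum[of m]] show ?case
    by (simp add: add.commute)
qed

end

section \<open>Order of vanishing at the root of unity\<close>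

definition ord_ge :: "nat \<Rightarrow> complex fls \<Rightarrow> bool" where
  "ord_ge m f \<longleftrightarrow> (\<exists>g. f = fls_X ^ m * fps_to_fls g)"

lemma fps_X_dvd_if_nth_0:
  fixes f :: "complex fps"
  assumes "fps_nth f 0 = 0"
  shows "fps_X dvd f"
proof -
  have "f = fps_X * fps_shift 1 f"
    using assms by (intro fps_ext) auto
  thus ?thesis by (metis dvd_triv_left)
qed

lemma has_value_0_imp_ord_ge: "has_value f 0 \<Longrightarrow> ord_ge 1 f"
proof -
  assume "has_value f 0"
  then obtain g where g: "f = fps_to_fls g" "fps_nth g 0 = 0" by (auto simp: has_value_def)
  hence "g = fps_X * fps_shift 1 g"
    by (intro fps_ext) auto
  hence "f = fps_to_fls (fps_X * fps_shift 1 g)" using g by simp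
  thus ?thesis
    unfolding ord_ge_def by (intro exI[of _ "fps_shift 1 g"]) (simp add: fls_times_fps_to_fls)
qed

lemma ord_ge_mono: "ord_ge k f \<Longrightarrow> m \<le> k \<Longrightarrow> ord_ge m f"
proof -
  assume "ord_ge k f" "m \<le> k"
  then obtain g where "f = fls_X ^ k * fps_to_fls g" by (auto simp: ord_ge_def)
  moreover have "fls_X ^ k = fls_X ^ m * (fps_to_fls (fps_X ^ (k - m)) :: complex fls)"
    using \<open>m \<le> k\<close> by (simp add: fps_to_fls_power flip: power_add)
  ultimately show ?thesis
    unfolding ord_ge_def by (metis fls_times_fps_to_fls mult.assoc)
qed

lemma ord_ge_mult_has_value: "ord_ge m f \<Longrightarrow> has_value g c \<Longrightarrow> ord_ge m (f * g)"
  unfolding ord_ge_def has_value_def by (metis fls_times_fps_to_fls mult.assoc)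

text \<open>Modulo \<open>fps_X\<close> the polynomial \<open>F\<close> vanishes at all complex
  \<open>y\<close>, so \<open>fps_X\<close> divides every coefficient. With
  \<open>F = pCons a G\<close>, the root gives \<open>a = - (Y * poly G Y)\<close>: two powers come
  from \<open>Y\<close>, a third from the coefficients of \<open>G\<close>.\<close>

lemma poly_fps_vanish_order:
  fixes F :: "complex fps poly"
  assumes F0: "\<And>y. fps_nth (poly F (fps_const y)) 0 = 0"
    and Y: "fps_X\<^sup>2 dvd Y" and root: "poly F Y = 0"
  shows "fps_X ^ 3 dvd poly F 0"
proof -
  define p where "p = map_poly (\<lambda>f. fps_nth f 0) F"
  have "poly p y = fps_nth (poly F (fps_const y)) 0" for y
    unfolding p_def by (induction F) (auto simp: map_poly_pCons)
  hence "p = 0"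
    using F0 poly_all_0_iff_0 by metis
  hence c0: "fps_nth (Polynomial.coeff F i) 0 = 0" for i
    by (simp add: p_def poly_eq_iff coeff_map_poly)
  hence c: "fps_X dvd Polynomial.coeff F i" for i
    by (rule fps_X_dvd_if_nth_0)
  obtain a G where F: "F = pCons a G" by (cases F)
  have "fps_X dvd poly G Y"
    unfolding poly_altdef
  proof (intro dvd_sum dvd_mult2)
    fix i show "fps_X dvd Polynomial.coeff G i" using c[of "Suc i"] by (simp add: F)
  qed
  hence "fps_X\<^sup>2 * fps_X dvd Y * poly G Y"
    using Y by (intro mult_dvd_mono)
  moreover have "a = - (Y * poly G Y)"
    using root by (simp add: F eq_neg_iff_add_eq_0)
  ultimately show ?thesis
    by (simp add: F eval_nat_numeral mult_ac)
qed

lemma fps_to_fls_sum: "fps_to_fls (sum f A) = (\<Sum>x\<in>A. fps_to_fls (f x))"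
  by (induction A rule: infinite_finite_induct) auto

lemma fps_to_fls_prod: "fps_to_fls (prod f A) = (\<Prod>x\<in>A. fps_to_fls (f x :: complex fps))"
  by (induction A rule: infinite_finite_induct) (auto simp: fls_times_fps_to_fls)

lemma fps_to_fls_pair_factor: "fps_to_fls (pair_factor r s y z j) = pair_factor r s (fps_to_fls y) (fps_to_fls z :: complex fls) j"
  by (simp add: pair_factor_def fls_times_fps_to_fls fps_to_fls_power)

lemma fps_to_fls_num_sum:
  "fps_to_fls (num_sum c z M y) =
     num_sum (\<lambda>k. fps_to_fls (c k)) (fps_to_fls z :: complex fls) M (fps_to_fls y)"
  by (simp add: num_sum_def fps_to_fls_sum fls_times_fps_to_fls fps_to_fls_prod fps_to_fls_pair_factor)

lemma fps_nth_prod_0: "fps_nth (prod f A) 0 = (\<Prod>x\<in>A. fps_nth (f x :: complex fps) 0)"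
  by (induction A rule: infinite_finite_induct) auto

lemma fps_nth_power_0: "fps_nth (f ^ k) 0 = fps_nth (f :: complex fps) 0 ^ k"
  by (induction k) auto

lemma fps_nth_pair_factor: "fps_nth (pair_factor r s y z j) 0 = pair_factor r s (fps_nth y 0) (fps_nth (z :: complex fps) 0) j"
  by (simp add: pair_factor_def fps_nth_power_0)

lemma fps_nth_num_sum:
  "fps_nth (num_sum c z M y) 0 =
     num_sum (\<lambda>k. fps_nth (c k) 0) (fps_nth (z :: complex fps) 0) M (fps_nth y 0)"
  by (simp add: num_sum_def fps_sum_nth fps_nth_prod_0 fps_nth_pair_factor)

lemma num_sum_cong: "(\<And>k. k \<le> M \<Longrightarrow> c k = c' k) \<Longrightarrow> num_sum c z M y = num_sum c' z M y"
  unfolding num_sum_def by (intro sum.cong) auto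

lemma prod_pair_factor_poly: "\<exists>p. \<forall>y. poly p y = (\<Prod>j<M. pair_factor r s y z j)"
  by (rule exI[of _ "\<Prod>j<M. [:(1 - z ^ (r + s * j))\<^sup>2, - (z ^ (r + s * j)):]"])
     (simp add: poly_prod pair_factor_def)

context primitive_root begin

text \<open>\<open>poly_fps_vanish_order\<close> is applied to the difference of both sides, cleared
  of denominators, as a polynomial in \<open>y\<close> over the power series at
  \<open>\<zeta>\<close>. The coefficients vanish at \<open>\<zeta>\<close> by the sum over one
  period; the root is supplied by the evaluation at \<open>a = q^d\<close>.\<close>

lemma ord_ge_3_if_order_eq:
  "ord_ge 3 ((\<Sum>k<d. sum_coeff k * tpoch 1 Z k) - inverse (Z ^ ((d - 1) div 2)) * (1 - Z ^ d) * of_int (chi_3 d))"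
proof -
  obtain \<kappa> where \<kappa>: "\<forall>k<d. has_value (sum_coeff k) (lim_coeff \<zeta> d \<kappa> k)"
    using has_value_sum_coeff by blast
  then obtain cf where cf: "\<And>k. k < d \<Longrightarrow> sum_coeff k = fps_to_fls (cf k) \<and> fps_nth (cf k) 0 = lim_coeff \<zeta> d \<kappa> k"
    unfolding has_value_def by metis
  define z where "z = shifted_var \<zeta>"
  have z0: "fps_nth z 0 = \<zeta>" by (simp add: z_def)
  have zd0: "fps_nth (1 - z ^ d) 0 = 0"
    using \<zeta>_power_eq_1_iff[of d] by (simp add: fps_nth_power_0 z0)
  define R where "R = inverse (z ^ ((d - 1) div 2)) * (1 - z ^ d) * of_int (chi_3 d)"
  have R0: "fps_nth R 0 = 0"
    using zd0 by (simp add: R_def)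
  have Zz: "fps_to_fls z = Z" by (simp add: z_def Z_def)
  have RR: "fps_to_fls R = inverse (Z ^ ((d - 1) div 2)) * (1 - Z ^ d) * of_int (chi_3 d)"
    using \<zeta>_nz by (simp add: R_def fls_times_fps_to_fls fps_to_fls_inverse fps_nth_power_0 z0
        fps_to_fls_power Zz fps_to_fls_of_int)
  define W where "W = (\<lambda>y. \<Prod>j<d - 1. pair_factor 6 6 y z j)"
  obtain p1 where p1: "\<And>y. poly p1 y = num_sum cf z (d - 1) y"
    using num_sum_poly by blast
  obtain p2 where p2: "\<And>y. poly p2 y = W y"
    unfolding W_def using prod_pair_factor_poly by blast
  \<comment> \<open>\<open>R\<close> is the claimed right-hand side times \<open>1 - q\<close>, and
    \<open>W\<close> is the common denominator. As \<open>R\<close> vanishes at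
    \<open>\<zeta>\<close>, only the sum over one period matters modulo
    \<open>fps_X\<close>.\<close>
  define F where "F = p1 - Polynomial.smult R p2"
  have F: "poly F y = num_sum cf z (d - 1) y - R * W y" for y
    by (simp add: F_def p1 p2)
  have lt: "k < d" if "k \<le> d - 1" for k using that d1 by simp
  have FF: "fps_to_fls (poly F y) = num_sum sum_coeff Z (d - 1) (fps_to_fls y) -
      fps_to_fls R * (\<Prod>j<d - 1. pair_factor 6 6 (fps_to_fls y) Z j)" for y
  proof -
    have "num_sum (\<lambda>k. fps_to_fls (cf k)) Z (d - 1) (fps_to_fls y) = num_sum sum_coeff Z (d - 1) (fps_to_fls y)"
      using cf lt by (intro num_sum_cong) auto
    thus ?thesis
      by (simp add: F fps_to_fls_num_sum fls_times_fps_to_fls W_def fps_to_fls_prod fps_to_fls_pair_factor Zz)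
  qed
  have "fps_nth (poly F (fps_const y)) 0 = 0" for y
  proof -
    have "num_sum (\<lambda>k. fps_nth (cf k) 0) \<zeta> (d - 1) y = num_sum (lim_coeff \<zeta> d \<kappa>) \<zeta> (d - 1) y"
      using cf lt by (intro num_sum_cong) auto
    thus ?thesis
      using num_sum_lim_coeff_eq_0[OF prim d6 d1, of \<kappa> y]
      by (simp add: F fps_nth_num_sum z0 R0)
  qed
  moreover
  define Y where "Y = (1 - z ^ d)\<^sup>2 * inverse (z ^ d)"
  have "fps_X dvd 1 - z ^ d"
    using zd0 by (rule fps_X_dvd_if_nth_0)
  hence "fps_X\<^sup>2 dvd Y"
    unfolding Y_def by (intro dvd_mult2 dvd_power_same)
  moreover have "poly F Y = 0"
  proof -
    define a where "a = Z ^ d"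
    have a0: "a \<noteq> 0" using Z_nz by (simp add: a_def)
    have Ya: "fps_to_fls Y = (1 - a)\<^sup>2 * inverse a"
      using \<zeta>_nz by (simp add: Y_def a_def fls_times_fps_to_fls fps_to_fls_inverse
        fps_nth_power_0 z0 fps_to_fls_power Zz)
    have nz: "pair_factor 6 6 ((1 - a)\<^sup>2 * inverse a) Z j \<noteq> 0" for j
    proof -
      define v where "v = Z ^ (6 + 6 * j)"
      have "pair_factor 6 6 ((1 - a)\<^sup>2 * inverse a) Z j = (1 - a * v) * (1 - v * inverse a)"
        using a0 unfolding pair_factor_def v_def [symmetric] by (simp add: field_simps power2_eq_square)
      moreover have "a * v \<noteq> 1"
        using Z_power_neq_1[of "d + (6 + 6 * j)"] by (simp add: a_def v_def power_add)
      moreover have "v \<noteq> a"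
      proof -
        \<comment> \<open>The denominator factor \<open>1 - v / a\<close> could vanish only for
          \<open>6 + 6 * j = d\<close>, which parity forbids.\<close>
        have "6 + 6 * j \<noteq> d" using odd_d by auto
        thus ?thesis
          unfolding v_def a_def using power_eq_power_iff[OF Z_nz Z_power_neq_1] by blast
      qed
      hence "v * inverse a \<noteq> 1"
        using a0 by (auto simp: field_simps)
      ultimately show ?thesis by simp
    qed
    have "num_sum sum_coeff Z (d - 1) ((1 - a)\<^sup>2 * inverse a) =
        (\<Prod>j<d - 1. pair_factor 6 6 ((1 - a)\<^sup>2 * inverse a) Z j) * (\<Sum>k\<le>d - 1. sum_coeff k * tpoch a Z k)"
      using a0 nz by (intro num_sum_eq) auto
    also have "(\<Sum>k\<le>d - 1. sum_coeff k * tpoch a Z k) =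
        (\<Sum>k\<le>d - 1. cubic_term 0 (Z ^ Suc d) (Z * inverse (Z ^ d)) Z (Z\<^sup>2) k)"
      using cubic_term_eq_tpoch[OF a0 Z_nz] unfolding sum_coeff_def by (simp add: a_def mult.commute[of "Z ^ d" Z])
    also have "\<dots> = fps_to_fls R"
    proof -
      have "\<not> 3 dvd d"
        using coprime_6_d by (auto simp: coprime_def elim!: allE[of _ 3])
      hence "d mod 3 \<noteq> 0" by (simp add: dvd_eq_mod_eq_0)
      moreover have "d \<le> 2 * (d - 1)" using d1 by simp
      ultimately have "Z ^ ((d - 1) div 2) * (\<Sum>k\<le>d - 1. cubic_term 0 (Z ^ Suc d) (Z * inverse (Z ^ d)) Z (Z\<^sup>2) k)
          = (1 - Z ^ d) * of_int (chi_3 d)"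
        using Z_nz Z_power_neq_1 odd_d by (intro sum_cubic_terminating) auto
      thus ?thesis
        unfolding RR using Z_nz by (simp add: field_simps)
    qed
    finally have "fps_to_fls (poly F Y) = 0"
      unfolding FF Ya by simp
    thus ?thesis by simp
  qed
  ultimately have "fps_X ^ 3 dvd poly F 0"
    by (rule poly_fps_vanish_order)
  then obtain g where g: "poly F 0 = fps_X ^ 3 * g" by (elim dvdE)
  \<comment> \<open>At \<open>y = 0\<close> the cleared denominator is a unit, so dividing by it
    preserves the order 3.\<close>
  have W0: "fps_nth (W 0) 0 \<noteq> 0"
  proof -
    have "pair_factor 6 6 0 \<zeta> j \<noteq> 0" if "j < d - 1" for j
    proof -
      have "\<not> d dvd 6 * Suc j"
        using that coprime_6_d by (metis coprime_commute coprime_dvd_mult_right_iff dvd_imp_le less_diff_conv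
            not_less plus_1_eq_Suc add.commute zero_less_Suc)
      hence "\<zeta> ^ (6 + 6 * j) \<noteq> 1"
        using \<zeta>_power_eq_1_iff[of "6 + 6 * j"] by simp
      thus ?thesis by (simp add: pair_factor_def)
    qed
    thus ?thesis
      by (simp add: W_def fps_nth_prod_0 fps_nth_pair_factor z0)
  qed
  have FW: "fps_to_fls (W 0) = (\<Prod>j<d - 1. pair_factor 6 6 ((1 - 1)\<^sup>2 * inverse 1) Z j)"
    by (simp add: W_def fps_to_fls_prod fps_to_fls_pair_factor Zz)
  have W0': "fps_to_fls (W 0) \<noteq> 0" using W0 by auto
  have "num_sum sum_coeff Z (d - 1) ((1 - 1)\<^sup>2 * inverse 1) =
      (\<Prod>j<d - 1. pair_factor 6 6 ((1 - 1)\<^sup>2 * inverse 1) Z j) * (\<Sum>k\<le>d - 1. sum_coeff k * tpoch 1 Z k)"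
    using W0' unfolding FW by (intro num_sum_eq) auto
  hence "fps_to_fls (poly F 0) = fps_to_fls (W 0) * ((\<Sum>k\<le>d - 1. sum_coeff k * tpoch 1 Z k) - fps_to_fls R)"
    using FF[of 0] FW by (simp add: right_diff_distrib)
  hence "(\<Sum>k\<le>d - 1. sum_coeff k * tpoch 1 Z k) - fps_to_fls R = fps_to_fls (poly F 0) * inverse (fps_to_fls (W 0))"
    using W0' by (simp add: field_simps)
  also have "\<dots> = fls_X ^ 3 * fps_to_fls (g * inverse (W 0))"
    using W0 by (simp add: g fls_times_fps_to_fls fps_to_fls_inverse fps_to_fls_power mult.assoc)
  finally have "ord_ge 3 ((\<Sum>k\<le>d - 1. sum_coeff k * tpoch 1 Z k) - fps_to_fls R)"
    unfolding ord_ge_def by blast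
  moreover have "{..d - 1} = {..<d}" using d1 by auto
  ultimately show ?thesis
    unfolding RR by simp
qed

end

subsection \<open>Evaluating rational functions in Laurent series\<close>

text \<open>Injectivity lets the homomorphism extend to the fraction field, so that rational
  functions in \<open>q\<close> can be expanded at a root of unity. \<open>ext\<close> picks an
  arbitrary representation; \<open>ext_Fract\<close> shows that the choice is immaterial.\<close>

locale fract_hom =
  fixes \<phi> :: "'a::idom \<Rightarrow> 'b::field"
  assumes add: "\<phi> (x + y) = \<phi> x + \<phi> y" and mult: "\<phi> (x * y) = \<phi> x * \<phi> y"
    and one: "\<phi> 1 = 1" and inj: "\<phi> x = 0 \<Longrightarrow> x = 0"
begin

definition ext :: "'a fract \<Rightarrow> 'b" where
  "ext x = (let p = SOME p. snd p \<noteq> 0 \<and> x = Fract (fst p) (snd p) in \<phi> (fst p) / \<phi> (snd p))"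

lemma zero: "\<phi> 0 = 0"
  using add[of 0 0] by (metis add.right_neutral add_left_cancel)

lemma ext_Fract: 
  assumes "b \<noteq> 0"
  shows "ext (Fract a b) = \<phi> a / \<phi> b"
proof -
  define p where "p = (SOME p. snd p \<noteq> 0 \<and> Fract a b = Fract (fst p) (snd p))"
  have "snd p \<noteq> 0 \<and> Fract a b = Fract (fst p) (snd p)"
    unfolding p_def by (rule someI[of _ "(a, b)"]) (use assms in auto)
  hence p: "snd p \<noteq> 0" "a * snd p = fst p * b"
    using assms by (auto simp: eq_fract)
  hence "\<phi> a * \<phi> (snd p) = \<phi> (fst p) * \<phi> b"
    by (metis mult)
  moreover have "\<phi> (snd p) \<noteq> 0" "\<phi> b \<noteq> 0"
    using p assms inj by auto
  ultimately show ?thesis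
    by (simp add: ext_def p_def [symmetric] Let_def divide_simps)
qed

lemma ext_add: "ext (x + y) = ext x + ext y"
proof (cases x, cases y)
  fix a b c d assume "x = Fract a b" "b \<noteq> 0" "y = Fract c d" "d \<noteq> 0"
  moreover have "\<phi> b \<noteq> 0" "\<phi> d \<noteq> 0" using calculation inj by auto
  ultimately show ?thesis
    by (simp add: ext_Fract add mult divide_simps)
qed

lemma ext_mult: "ext (x * y) = ext x * ext y"
proof (cases x, cases y)
  fix a b c d assume "x = Fract a b" "b \<noteq> 0" "y = Fract c d" "d \<noteq> 0"
  thus ?thesis by (simp add: ext_Fract mult)
qed

lemma ext_1: "ext 1 = 1"
  by (simp add: One_fract_def ext_Fract one)

lemma ext_0: "ext 0 = 0"
  by (simp add: Zero_fract_def ext_Fract zero)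

lemma ext_minus: "ext (- x) = - ext x"
  using ext_add[of x "- x"] by (simp add: ext_0 eq_neg_iff_add_eq_0 add.commute)

lemma ext_diff: "ext (x - y) = ext x - ext y"
  using ext_add[of x "- y"] by (simp add: ext_minus)

lemma ext_inverse: "ext (inverse x) = inverse (ext x)"
proof (cases "x = 0")
  case False
  hence "ext x * ext (inverse x) = 1"
    by (simp flip: ext_mult add: ext_1)
  thus ?thesis by (simp add: inverse_unique)
qed (simp add: ext_0)

lemma ext_divide: "ext (x / y) = ext x / ext y"
  unfolding divide_inverse by (simp add: ext_mult ext_inverse)

lemma ext_power: "ext (x ^ n) = ext x ^ n"
  by (induction n) (simp_all add: ext_1 ext_mult)

lemma ext_power_int: "ext (x powi n) = ext x powi n"
  by (simp add: power_int_def ext_power ext_inverse)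

lemma ext_sum: "ext (sum f A) = (\<Sum>x\<in>A. ext (f x))"
  by (induction A rule: infinite_finite_induct) (simp_all add: ext_0 ext_add)

lemma ext_prod: "ext (prod f A) = (\<Prod>x\<in>A. ext (f x))"
  by (induction A rule: infinite_finite_induct) (simp_all add: ext_1 ext_mult)

lemma ext_of_nat: "ext (of_nat n) = of_nat n"
  by (induction n) (simp_all add: ext_0 ext_1 ext_add)

lemma ext_of_int: "ext (of_int n) = of_int n"
  by (cases n) (simp_all add: ext_of_nat ext_minus ext_diff ext_1)

lemma ext_qpoch: "ext (qpoch a q k) = qpoch (ext a) (ext q) k"
  by (simp add: qpoch_def ext_prod ext_diff ext_1 ext_mult ext_power)

end

section \<open>Integer polynomials and their fractions expanded at a root of unity\<close>

lemma has_value_poly: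
  "has_value z c \<Longrightarrow> has_value (poly (map_poly fls_const p) z) (poly p c)"
proof (induction p)
  case (pCons a p)
  have "has_value (fls_const a) a"
    by (rule has_valueI[of _ "fps_const a"]) auto
  with pCons show ?case
    by (auto simp: map_poly_pCons intro!: has_value_add has_value_mult)
qed (simp add: has_value_0)

context primitive_root begin

definition ev :: "int poly \<Rightarrow> complex fls" where
  "ev p = poly (map_poly of_int p) Z"

lemma ev_eq: "ev p = poly (map_poly fls_const (map_poly of_int p)) Z"
  unfolding ev_def by (subst map_poly_map_poly) (auto simp: o_def simp flip: fls_of_int)

lemma map_poly_fls_const_mult:
  "map_poly fls_const (p * q) = map_poly fls_const p * map_poly fls_const (q :: complex poly)"
proof (rule poly_eqI)
  have *: "fls_const (sum f A) = (\<Sum>x\<in>A. fls_const (f x :: complex))" for f and A :: "nat set"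
    by (induction A rule: infinite_finite_induct) (auto simp flip: fls_plus_const)
  fix n show "Polynomial.coeff (map_poly fls_const (p * q)) n =
      Polynomial.coeff (map_poly fls_const p * map_poly fls_const q) n"
    by (simp add: coeff_map_poly coeff_mult * fls_const_mult_const)
qed

lemma Z_minus: "Z - fls_const \<zeta> = fls_X"
  by (simp add: Z_def shifted_var_def)

text \<open>The linear factor \<open>[:- \<zeta>, 1:]\<close> is sent to \<open>fls_X\<close>, and
  the cofactor left after its maximal power is nonzero at \<open>\<zeta>\<close>. So root
  multiplicity is the exact order of the expansion; in particular \<open>ev\<close> is
  injective.\<close>

lemma ev_order:
  assumes "p \<noteq> 0"
  shows "\<exists>u c. ev p = fls_X ^ Polynomial.order \<zeta> (map_poly of_int p) * u \<and> c \<noteq> 0 \<and> has_value u c"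
proof -
  define P where "P = (map_poly of_int p :: complex poly)"
  have "P \<noteq> 0"
    using assms of_int_poly_eq_iff[of p 0, where 'a = complex] by (simp add: P_def)
  then obtain Q where Q: "P = [:- \<zeta>, 1:] ^ Polynomial.order \<zeta> P * Q" "\<not> [:- \<zeta>, 1:] dvd Q"
    using order_decomp by blast
  have "poly (map_poly fls_const ([:- \<zeta>, 1:] ^ k)) Z = fls_X ^ k" for k
  proof (induction k)
    case (Suc k)
    have "poly (map_poly fls_const [:- \<zeta>, 1:]) Z = fls_X"
      using Z_minus by (simp add: map_poly_pCons)
    with Suc show ?case
      by (simp add: map_poly_fls_const_mult del: mult_pCons_left)
  qed simp
  hence "ev p = fls_X ^ Polynomial.order \<zeta> P * poly (map_poly fls_const Q) Z"
    unfolding ev_eq P_def [symmetric] by (subst Q(1)) (simp add: map_poly_fls_const_mult)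
  moreover have "poly Q \<zeta> \<noteq> 0"
    using Q(2) by (simp add: poly_eq_0_iff_dvd)
  ultimately show ?thesis
    unfolding P_def using has_value_poly[OF has_value_Z] by blast
qed

sublocale fh: fract_hom ev
proof
  fix x y :: "int poly"
  show "ev (x + y) = ev x + ev y" "ev (x * y) = ev x * ev y" "ev 1 = 1"
    by (simp_all add: ev_def of_int_poly_add of_int_poly_mult)
  show "x = 0" if "ev x = 0"
    using ev_order[of x] that by (auto simp: has_value_def)
qed

lemma ev_qvar: "fh.ext qvar = Z"
  by (simp add: qvar_def to_fract_def fh.ext_Fract fh.one) (simp add: ev_def qX_def map_poly_pCons)

text \<open>\<open>ev b\<close> is regular, so multiplying by it cannot lower the order; the order
  of \<open>ev a\<close> is the root multiplicity by \<open>ev_order\<close>.\<close>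

lemma ord_ge_order:
  assumes "ord_ge m (fh.ext (Fract a b))" "b \<noteq> 0" "a \<noteq> 0"
    and "poly (map_poly of_int b) \<zeta> \<noteq> 0"
  shows "m \<le> Polynomial.order \<zeta> (map_poly of_int a)"
proof -
  obtain g where g: "ev a / ev b = fls_X ^ m * fps_to_fls g"
    using assms by (auto simp: ord_ge_def fh.ext_Fract)
  obtain u c where u: "ev a = fls_X ^ Polynomial.order \<zeta> (map_poly of_int a) * u" "c \<noteq> 0" "has_value u c"
    using ev_order[OF assms(3)] by blast
  have b: "has_value (ev b) (poly (map_poly of_int b) \<zeta>)"
    unfolding ev_eq by (rule has_value_poly[OF has_value_Z])
  have b0: "ev b \<noteq> 0" using assms(2) fh.inj by auto
  define k where "k = Polynomial.order \<zeta> (map_poly of_int a :: complex poly)"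
  obtain u' where u': "u = fps_to_fls u'" "fps_nth u' 0 = c" using u(3) by (auto simp: has_value_def)
  obtain b' where b': "ev b = fps_to_fls b'" using b by (auto simp: has_value_def)
  have "fls_X ^ k * u = fls_X ^ m * fps_to_fls g * ev b"
    using g b0 u(1) by (simp add: k_def field_simps)
  hence "fps_to_fls (fps_X ^ k * u') = fps_to_fls (fps_X ^ m * (g * b'))"
    by (simp add: fls_times_fps_to_fls fps_to_fls_power u' b' mult.assoc)
  hence eq: "fps_X ^ k * u' = fps_X ^ m * (g * b')"
    by (simp only: fps_to_fls_eq_iff)
  show ?thesis
  proof (rule ccontr)
    assume "\<not> ?thesis"
    hence "k < m" by (simp add: k_def)
    have "fps_nth (fps_X ^ k * u') k = 0"
      unfolding eq using \<open>k < m\<close> by (simp add: fps_X_power_mult_nth)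
    thus False using u(2) u' by (simp add: fps_X_power_mult_nth)
  qed
qed

text \<open>Serves to contradict the absence of common roots: where the fraction is regular, a zero
  of the denominator is one of the numerator.\<close>

lemma ord_ge_root:
  assumes "ord_ge 1 (fh.ext (Fract a b))" "b \<noteq> 0"
    and "poly (map_poly of_int b) \<zeta> = 0"
  shows "poly (map_poly of_int a) \<zeta> = 0"
proof -
  obtain g where "ev a / ev b = fls_X * fps_to_fls g"
    using assms by (auto simp: ord_ge_def fh.ext_Fract)
  moreover have "ev b \<noteq> 0" using assms(2) fh.inj by auto
  ultimately have e: "ev a = fls_X * fps_to_fls g * ev b" by (simp add: field_simps)
  have r: "has_value (ev p) (poly (map_poly of_int p) \<zeta>)" for p
    unfolding ev_eq by (rule has_value_poly[OF has_value_Z])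
  have "has_value fls_X 0" by (rule has_valueI[of _ fps_X]) auto
  moreover have "has_value (fps_to_fls g) (fps_nth g 0)" by (rule has_valueI) auto
  ultimately have "has_value (ev a) (0 * fps_nth g 0 * poly (map_poly of_int b) \<zeta>)"
    unfolding e by (intro has_value_mult r)
  with r[of a] show ?thesis by (auto simp: has_value_def)
qed

end

subsection \<open>Divisibility over the integers\<close>

lemma dvd_of_order_le:
  fixes p q :: "complex poly"
  assumes "q \<noteq> 0" "p \<noteq> 0" "\<And>z. poly p z = 0 \<Longrightarrow> Polynomial.order z p \<le> Polynomial.order z q"
  shows "p dvd q"
  using assms
proof (induction "degree p" arbitrary: p q)
  case 0
  thus ?case by (metis dvd_trans is_unit_iff_degree one_dvd unit_imp_dvd)
next
  case (Suc n)
  have "\<not> constant (poly p)"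
    using Suc(2) by (simp add: constant_degree)
  from Fundamental_Theorem_Algebra.fundamental_theorem_of_algebra[OF this] obtain z where z: "poly p z = 0" ..
  then obtain p' where p': "p = [:- z, 1:] * p'"
    unfolding poly_eq_0_iff_dvd by (elim dvdE)
  have "Polynomial.order z p \<noteq> 0"
    using z Suc.prems by (simp add: order_root)
  hence "poly q z = 0"
    using Suc.prems(3)[OF z] by (simp add: order_root)
  then obtain q' where q': "q = [:- z, 1:] * q'"
    unfolding poly_eq_0_iff_dvd by (elim dvdE)
  have nz: "p' \<noteq> 0" "q' \<noteq> 0" using Suc.prems p' q' by auto
  have "degree p = Suc (degree p')"
    unfolding p' using nz by (subst degree_mult_eq) auto
  moreover have "Polynomial.order x p' \<le> Polynomial.order x q'" if "poly p' x = 0" for x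
  proof -
    have "poly p x = 0" using that by (simp add: p')
    from Suc.prems(3)[OF this] show ?thesis
      using Suc.prems(1,2) unfolding p' q' by (simp add: order_mult del: mult_pCons_left)
  qed
  ultimately have "p' dvd q'"
    using Suc(1)[of p' q'] Suc(2) nz by auto
  thus ?case unfolding p' q' by (rule mult_dvd_mono[OF dvd_refl])
qed

text \<open>Pseudo-division by a monic polynomial is division with remainder over the integers, and
  a remainder divisible by \<open>P\<close> over the complex numbers is zero by degree.\<close>

lemma monic_dvd_of_int:
  fixes P A :: "int poly"
  assumes lc: "lead_coeff P = 1"
    and dvd: "(map_poly of_int P :: complex poly) dvd map_poly of_int A"
  shows "P dvd A"
proof -
  have P0: "P \<noteq> 0" using lc by auto
  obtain q r where qr: "pseudo_divmod A P = (q, r)" by force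
  have A: "A = P * q + r" and r: "r = 0 \<or> degree r < degree P"
    using pseudo_divmod[OF P0 qr] lc by simp_all
  have "(map_poly of_int P :: complex poly) dvd map_poly of_int r"
    using dvd unfolding A of_int_poly_add of_int_poly_mult by (simp add: dvd_add_right_iff)
  hence "(map_poly of_int r :: complex poly) = 0"
    using r dvd_imp_degree_le[of "map_poly of_int P :: complex poly" "map_poly of_int r"]
    unfolding degree_of_int_poly by (cases "r = 0") auto
  hence "r = 0"
    using of_int_poly_eq_iff[of r 0, where 'a = complex] by simp
  thus ?thesis using A by simp
qed

text \<open>
  A representation with a denominator of minimal degree works: if \<open>m\<close> is an integer polynomial
  of minimal degree with root \<open>z\<close>, pseudo-division shows that up to constants \<open>m\<close> divides
  every integer polynomial vanishing at \<open>z\<close>, so it could be cancelled.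
\<close>

lemma Fract_no_common_root:
  fixes x :: "int poly fract"
  shows "\<exists>a b. b \<noteq> 0 \<and> x = Fract a b \<and>
    (\<forall>z::complex. \<not> (poly (map_poly of_int a) z = 0 \<and> poly (map_poly of_int b) z = 0))"
proof -
  define R where "R = (\<lambda>k. \<exists>a b. b \<noteq> 0 \<and> x = Fract a b \<and> degree b = k)"
  have "\<exists>k. R k"
    unfolding R_def by (cases x) auto
  hence "R (LEAST k. R k)" by (rule LeastI_ex)
  then obtain a b where ab: "b \<noteq> 0" "x = Fract a b" "degree b = (LEAST k. R k)"
    unfolding R_def by blast
  have False if z: "poly (map_poly of_int a) z = 0" "poly (map_poly of_int b) z = 0" for z :: complex
  proof -
    define M where "M = (\<lambda>k. \<exists>m::int poly. m \<noteq> 0 \<and> poly (map_poly of_int m) z = 0 \<and> degree m = k)"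
    have "\<exists>k. M k" unfolding M_def using z ab by blast
    hence "M (LEAST k. M k)" by (rule LeastI_ex)
    then obtain m where m: "m \<noteq> 0" "poly (map_poly of_int m) z = 0" "degree m = (LEAST k. M k)"
      unfolding M_def by blast
    have dm: "degree m \<noteq> 0"
    proof
      assume "degree m = 0"
      then obtain c where "m = [:c:]" by (elim degree_eq_zeroE)
      with m show False by (simp add: map_poly_pCons)
    qed
    have div: "\<exists>c q. c \<noteq> 0 \<and> Polynomial.smult c f = m * q" if f: "poly (map_poly of_int f) z = 0" for f
    proof -
      obtain q r where qr: "pseudo_divmod f m = (q, r)" by force
      define c where "c = lead_coeff m ^ (Suc (degree f) - degree m)"
      have fq: "Polynomial.smult c f = m * q + r" and r: "r = 0 \<or> degree r < degree m"
        using pseudo_divmod[OF m(1) qr] by (simp_all add: c_def)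
      have "c \<noteq> 0" using m(1) by (simp add: c_def)
      have "(map_poly of_int (Polynomial.smult c f) :: complex poly) = map_poly of_int ([:c:] * f)"
        by simp
      also have "\<dots> = [:of_int c:] * map_poly of_int f"
        unfolding of_int_poly_mult by (simp add: map_poly_pCons)
      finally have "poly (map_poly of_int (Polynomial.smult c f)) z = 0"
        using f by simp
      hence "poly (map_poly of_int r) z = 0"
        unfolding fq of_int_poly_add of_int_poly_mult using m by simp
      hence "r = 0"
        using r not_less_Least[of "degree r" M] m unfolding M_def by auto
      with fq \<open>c \<noteq> 0\<close> show ?thesis by auto
    qed
    obtain c1 q1 where c1: "c1 \<noteq> 0" "Polynomial.smult c1 a = m * q1" using div[OF z(1)] by blast
    obtain c2 q2 where c2: "c2 \<noteq> 0" "Polynomial.smult c2 b = m * q2" using div[OF z(2)] by blast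
    have q2: "q2 \<noteq> 0" using c2 ab by auto
    have "degree b = degree (Polynomial.smult c2 b)" using c2(1) by simp
    also have "\<dots> = degree m + degree q2"
      unfolding c2(2) using m q2 by (subst degree_mult_eq) auto
    finally have deg: "degree (Polynomial.smult c1 q2) < degree b"
      using dm c1 by simp
    have "m * (a * Polynomial.smult c1 q2) = m * (Polynomial.smult c2 q1 * b)"
    proof -
      have "m * (a * Polynomial.smult c1 q2) = Polynomial.smult c1 a * (m * q2)"
        by (simp add: mult_ac)
      also have "\<dots> = Polynomial.smult c2 (m * q1) * b"
        unfolding c1(2) c2(2) [symmetric] by (simp add: mult_ac)
      also have "\<dots> = m * (Polynomial.smult c2 q1 * b)"
        by (simp add: mult_ac)
      finally show ?thesis .
    qed
    hence "a * Polynomial.smult c1 q2 = Polynomial.smult c2 q1 * b"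
      using m(1) by (metis mult_left_cancel)
    hence "x = Fract (Polynomial.smult c2 q1) (Polynomial.smult c1 q2)"
      using ab c1 q2 by (simp add: eq_fract)
    moreover have "Polynomial.smult c1 q2 \<noteq> 0" using c1 q2 by simp
    ultimately have "R (degree (Polynomial.smult c1 q2))"
      unfolding R_def by blast
    hence "(LEAST k. R k) \<le> degree (Polynomial.smult c1 q2)"
      by (rule Least_le)
    with deg ab(3) show False by linarith
  qed
  with ab show ?thesis by blast
qed

text \<open>Absence of common complex roots excludes nonconstant common divisors. A constant one
  divides the leading coefficient 1 of \<open>P\<close>, hence is a unit.\<close>

lemma coprime_monic_int_poly:
  fixes P B :: "int poly"
  assumes lc: "lead_coeff P = 1"
    and nr: "\<And>z::complex. poly (map_poly of_int P) z = 0 \<Longrightarrow> poly (map_poly of_int B) z \<noteq> 0"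
  shows "coprime P B"
proof (rule coprimeI)
  fix g assume g: "g dvd P" "g dvd B"
  have lg: "lead_coeff g dvd 1"
    using g(1) lc by (auto simp: dvd_def lead_coeff_mult)
  have "degree g = 0"
  proof (rule ccontr)
    assume "degree g \<noteq> 0"
    hence "\<not> constant (poly (map_poly of_int g :: complex poly))"
      by (simp add: constant_degree degree_of_int_poly)
    from Fundamental_Theorem_Algebra.fundamental_theorem_of_algebra[OF this]
    obtain z where z: "poly (map_poly of_int g) z = (0 :: complex)" ..
    have "poly (map_poly of_int f) z = 0" if "g dvd f" for f
      using that z by (auto simp: of_int_poly_mult elim!: dvdE)
    with g nr show False by blast
  qed
  then obtain c where "g = [:c:]" by (elim degree_eq_zeroE)
  with lg show "is_unit g" by (simp add: is_unit_const_poly_iff)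
qed

section \<open>Roots of the modulus and their multiplicities\<close>

lemma prim_root_exists:
  assumes "\<zeta> ^ n = 1" "n > 0"
  obtains d where "prim_root \<zeta> d" "d dvd n" "d > 0"
proof -
  define d where "d = (LEAST k. k > 0 \<and> \<zeta> ^ k = 1)"
  have d: "d > 0 \<and> \<zeta> ^ d = 1"
    unfolding d_def by (rule LeastI[of _ n]) (use assms in auto)
  have "\<zeta> ^ i = 1 \<longleftrightarrow> d dvd i" for i
  proof
    assume "\<zeta> ^ i = 1"
    moreover have "\<zeta> ^ i = (\<zeta> ^ d) ^ (i div d) * \<zeta> ^ (i mod d)"
      by (simp flip: power_mult power_add)
    ultimately have "\<zeta> ^ (i mod d) = 1" using d by simp
    moreover have "i mod d < d" using d by simp
    ultimately have "i mod d = 0"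
      using not_less_Least[of "i mod d" "\<lambda>k. k > 0 \<and> \<zeta> ^ k = 1"] by (auto simp: d_def)
    thus "d dvd i" by auto
  qed (use d in \<open>auto simp: power_mult elim!: dvdE\<close>)
  with d assms show ?thesis by (intro that[of d]) (auto simp: prim_root_def)
qed

lemma cyclotomic_complex_root:
  assumes "poly (cyclotomic_complex n) \<zeta> = 0" "n > 0"
  shows "prim_root \<zeta> n"
proof -
  have "finite {j. 1 \<le> j \<and> j \<le> n \<and> gcd j n = 1}"
    by (rule finite_subset[of _ "{..n}"]) auto
  then obtain j where j: "gcd j n = 1" "\<zeta> = exp (2 * of_real pi * \<i> * of_nat j / of_nat n)"
    using assms by (auto simp: cyclotomic_complex_def poly_prod)
  have "\<zeta> ^ i = 1 \<longleftrightarrow> n dvd i" for i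
  proof -
    have "\<zeta> ^ i = exp (2 * of_real pi * \<i> * of_nat (j * i) / of_nat n)"
      unfolding j(2) by (simp add: exp_of_nat_mult [symmetric] mult_ac)
    hence "\<zeta> ^ i = 1 \<longleftrightarrow> n dvd j * i"
      using complex_root_unity_eq_1[of n "j * i"] assms(2) by simp
    also have "\<dots> \<longleftrightarrow> n dvd i"
      using j(1) by (metis coprime_commute coprime_dvd_mult_right_iff coprime_iff_gcd_eq_1)
    finally show ?thesis .
  qed
  thus ?thesis by (simp add: prim_root_def)
qed

lemma qnum_qX_mult: "qnum qX n * (qX - 1) = qX ^ n - 1"
proof -
  have "qX \<noteq> 1" by (simp add: qX_def one_pCons)
  hence "qnum qX n = (\<Sum>i<n. qX ^ i)" by (rule qnum_altdef)
  thus ?thesis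
    using one_diff_power_eq[of qX n] by (simp add: algebra_simps)
qed

lemma rsquarefree_X_power_minus_1:
  assumes "n > 0"
  shows "rsquarefree (Polynomial.monom 1 n - 1 :: complex poly)"
  using assms by (auto simp: rsquarefree_roots pderiv_diff pderiv_monom poly_monom power_0_left)

lemma of_int_qX_power: "map_poly of_int (qX ^ n - 1) = (Polynomial.monom 1 n - 1 :: complex poly)"
proof -
  have "qX ^ n = Polynomial.monom 1 n"
    by (induction n) (simp_all add: qX_def monom_Suc)
  thus ?thesis
    by (intro poly_eqI) (simp add: coeff_map_poly coeff_1)
qed

lemma lead_coeff_modulus:
  assumes "n > 0"
  shows "lead_coeff (qnum qX n * cyclotomic n ^ 2) = 1"
proof -
  have deg: "degree (Polynomial.monom 1 n - 1 :: int poly) = n"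
    using assms by (intro antisym degree_le le_degree) (auto simp: coeff_1)
  have "qX ^ n = Polynomial.monom 1 n"
    by (induction n) (simp_all add: qX_def monom_Suc)
  hence "lead_coeff (qX ^ n - 1) = 1"
    using assms deg by (simp add: coeff_1)
  moreover have "lead_coeff (qX - 1) = 1"
    by (simp add: qX_def one_pCons)
  ultimately have 1: "lead_coeff (qnum qX n) = 1"
    using arg_cong[OF qnum_qX_mult[of n], of lead_coeff] by (simp add: lead_coeff_mult)
  have "lead_coeff (map_poly of_int (cyclotomic n) :: complex poly) = 1"
    unfolding of_int_poly_cyclotomic[OF assms] by (rule lead_coeff_cyclotomic_complex)
  hence "lead_coeff (cyclotomic n) = 1"
    unfolding degree_of_int_poly by (simp add: coeff_map_poly)
  with 1 show ?thesis by (simp add: lead_coeff_mult lead_coeff_power)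
qed

text \<open>\<open>[n]\<close> and the cyclotomic polynomial both divide \<open>q^n - 1\<close>,
  which is squarefree, so each contributes simple roots. The squared cyclotomic factor adds 2 to the
  multiplicity, but only at primitive \<open>n\<close>-th roots.\<close>

lemma modulus_root:
  fixes \<zeta> :: complex
  assumes n: "n > 1" and root: "poly (map_poly of_int (qnum qX n * cyclotomic n ^ 2)) \<zeta> = 0"
  obtains d where "prim_root \<zeta> d" "d dvd n" "d > 1"
    "Polynomial.order \<zeta> (map_poly of_int (qnum qX n * cyclotomic n ^ 2)) \<le> (if d = n then 3 else 1)"
proof -
  define G where "G = (map_poly of_int (qnum qX n) :: complex poly)"
  define C where "C = cyclotomic_complex n"
  have n0: "n > 0" using n by simp
  have "poly G \<zeta> = 0 \<or> poly C \<zeta> = 0"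
    using root of_int_poly_cyclotomic[OF n0]
    by (simp add: of_int_poly_mult power2_eq_square G_def C_def)
  have GX: "G * [:-1, 1:] = Polynomial.monom 1 n - 1"
  proof -
    have "(map_poly of_int (qX - 1) :: complex poly) = [:-1, 1:]"
      by (simp add: qX_def one_pCons map_poly_pCons)
    thus ?thesis
      unfolding G_def of_int_qX_power [symmetric] qnum_qX_mult [symmetric] of_int_poly_mult by simp
  qed
  have C_dvd: "C dvd Polynomial.monom 1 n - 1"
    unfolding prod_cyclotomic_complex[OF n0, symmetric] C_def
    using n0 by (intro dvd_prodI) auto
  have sq: "Polynomial.order z (Polynomial.monom 1 n - 1 :: complex poly) \<le> 1" for z
    using rsquarefree_X_power_minus_1[OF n0] unfolding rsquarefree_def by (metis le_numeral_extra(4) zero_le)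
  have X0: "(Polynomial.monom 1 n - 1 :: complex poly) \<noteq> 0"
    using rsquarefree_X_power_minus_1[OF n0] by (simp add: rsquarefree_def)
  have oG: "Polynomial.order \<zeta> G \<le> 1"
    using dvd_imp_order_le[OF X0, of G \<zeta>] sq[of \<zeta>] GX by (metis dvd_triv_left order_trans)
  have oC: "Polynomial.order \<zeta> C \<le> 1"
    using dvd_imp_order_le[OF X0 C_dvd, of \<zeta>] sq[of \<zeta>] by linarith
  have G0: "G \<noteq> 0" using GX X0 by auto
  have C0: "C \<noteq> 0" using C_dvd X0 by auto
  have "poly (Polynomial.monom 1 n - 1) \<zeta> = 0"
  proof (cases "poly G \<zeta> = 0")
    case True
    thus ?thesis unfolding GX [symmetric] by simp
  next
    case False
    obtain k where "Polynomial.monom 1 n - 1 = C * k" using C_dvd by (elim dvdE)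
    moreover have "poly C \<zeta> = 0"
      using False \<open>poly G \<zeta> = 0 \<or> poly C \<zeta> = 0\<close> by simp
    ultimately show ?thesis by simp
  qed
  hence "\<zeta> ^ n = 1" by (simp add: poly_monom)
  then obtain d where d: "prim_root \<zeta> d" "d dvd n" "d > 0"
    using prim_root_exists n0 by blast
  \<comment> \<open>A root of \<open>[n]\<close> at 1 would be a double root of
    \<open>q^n - 1\<close>, and 1 is not a primitive \<open>n\<close>-th root of unity for
    \<open>n > 1\<close>.\<close>
  have "\<zeta> \<noteq> 1"
  proof
    assume "\<zeta> = 1"
    moreover have "\<not> prim_root 1 n"
      using n by (auto simp: prim_root_def intro!: exI[of _ 1])
    ultimately have "poly G 1 = 0"
      using \<open>poly G \<zeta> = 0 \<or> poly C \<zeta> = 0\<close> cyclotomic_complex_root[OF _ n0] by (auto simp: C_def)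
    then obtain H where "G = [:-1, 1:] * H"
      unfolding poly_eq_0_iff_dvd by (elim dvdE)
    hence "[:-1, 1:] ^ 2 dvd Polynomial.monom 1 n - (1 :: complex poly)"
      unfolding GX [symmetric] by (simp add: power2_eq_square mult_ac del: mult_pCons_left mult_pCons_right)
    thus False
      using sq[of 1] X0 by (simp add: order_divides)
  qed
  hence "d \<noteq> 1"
    using d(1)[unfolded prim_root_def, rule_format, of 1] by auto
  hence d1: "d > 1" using d by simp
  have "map_poly of_int (qnum qX n * cyclotomic n ^ 2) = G * C * C"
    using of_int_poly_cyclotomic[OF n0] by (simp add: of_int_poly_mult power2_eq_square G_def C_def mult.assoc)
  hence "Polynomial.order \<zeta> (map_poly of_int (qnum qX n * cyclotomic n ^ 2)) =
      Polynomial.order \<zeta> G + 2 * Polynomial.order \<zeta> C"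
    using G0 C0 by (simp add: order_mult)
  moreover have "Polynomial.order \<zeta> C = 0" if "d \<noteq> n"
  proof -
    have "\<not> prim_root \<zeta> n"
    proof
      assume *: "prim_root \<zeta> n"
      have "\<zeta> ^ d = 1"
        using d(1) by (simp add: prim_root_def)
      hence "n dvd d"
        using * by (simp add: prim_root_def)
      with d(2) that show False by (simp add: dvd_antisym)
    qed
    hence "poly C \<zeta> \<noteq> 0"
      using cyclotomic_complex_root[OF _ n0] by (auto simp: C_def)
    thus ?thesis by (simp add: order_root)
  qed
  ultimately show ?thesis
    using d d1 oG oC by (intro that[of d]) auto
qed

section \<open>From the local orders to the congruence\<close>

theorem theorem4:
  fixes n :: nat
  assumes "n > 0" and "coprime n 6"
  shows "ratfun_cong
    (\<Sum>k = 0..n - 1.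
        (qpoch qvar (qvar ^ 2) k) ^ 2 * qpoch qvar (qvar ^ 2) (2 * k)
        / (qpoch (qvar ^ 2) (qvar ^ 2) (2 * k) * (qpoch (qvar ^ 6) (qvar ^ 6) k) ^ 2)
        * qnum qvar (8 * k + 1) * qvar ^ (2 * k ^ 2))
    (qvar powi (- ((int n - 1) div 2)) * qnum qvar n * of_int (kronecker (-3) n))
    (qnum qX n * cyclotomic n ^ 2)"
proof -
  let ?L = "\<Sum>k = 0..n - 1.
        (qpoch qvar (qvar ^ 2) k) ^ 2 * qpoch qvar (qvar ^ 2) (2 * k)
        / (qpoch (qvar ^ 2) (qvar ^ 2) (2 * k) * (qpoch (qvar ^ 6) (qvar ^ 6) k) ^ 2)
        * qnum qvar (8 * k + 1) * qvar ^ (2 * k ^ 2)"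
  let ?R = "qvar powi (- ((int n - 1) div 2)) * qnum qvar n * of_int (kronecker (-3) n)"
  define P where "P = qnum qX n * cyclotomic n ^ 2"
  \<comment> \<open>This representation serves both requirements: the numerator is tested at the
    roots of \<open>P\<close>, and the denominator is to be coprime with \<open>P\<close>.\<close>
  obtain a b where ab: "b \<noteq> 0" "?L - ?R = Fract a b"
    "\<And>z::complex. \<not> (poly (map_poly of_int a) z = 0 \<and> poly (map_poly of_int b) z = 0)"
    using Fract_no_common_root[of "?L - ?R"] by blast
  show ?thesis
  proof (cases "n = 1")
    case True
    have "qvar \<noteq> 1"
      by (auto simp: qvar_def to_fract_def qX_def One_fract_def eq_fract one_pCons)
    hence "?L - ?R = Fract 0 1"
      by (simp add: True qnum_def kronecker_def Zero_fract_def [symmetric])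
    thus ?thesis
      unfolding ratfun_cong_def ratfun_cong_0_def by (intro exI[of _ 0] exI[of _ 1]) auto
  next
    case False
    hence n1: "n > 1" using assms by simp
    \<comment> \<open>The required local orders are the bounds for the multiplicities of the roots
      of \<open>P\<close> in \<open>modulus_root\<close>.\<close>
    have ord: "ord_ge (if d = n then 3 else 1) (fract_hom.ext (primitive_root.ev \<zeta>) (Fract a b))"
      if d: "prim_root \<zeta> d" "d dvd n" "d > 1" for \<zeta> d
    proof -
      have "coprime d 6"
        using assms(2) d(2) by (rule coprime_divisors[OF _ dvd_refl, rotated])
      then interpret primitive_root \<zeta> d
        using d by unfold_locales auto
      have nodd: "odd n"
        using assms(2) by (auto simp: coprime_def elim!: allE[of _ 2])
      \<comment> \<open>The difference of both sides times \<open>1 - q\<close>; this factor is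
        invertible at \<open>\<zeta>\<close> because \<open>d > 1\<close>.\<close>
      define T where "T = (\<Sum>k<n. sum_coeff k * tpoch 1 Z k) - inverse (Z ^ ((n - 1) div 2)) * (1 - Z ^ n) * of_int (chi_3 n)"
      have term_eq: "(qpoch Z (Z ^ 2) k) ^ 2 * qpoch Z (Z ^ 2) (2 * k)
        / (qpoch (Z ^ 2) (Z ^ 2) (2 * k) * (qpoch (Z ^ 6) (Z ^ 6) k) ^ 2)
        * ((1 - Z ^ (8 * k + 1)) / (1 - Z)) * Z ^ (2 * k ^ 2) = sum_coeff k * tpoch 1 Z k * inverse (1 - Z)" for k
        unfolding sum_coeff_def tpoch_1 qratio_def power_divide
        by (simp only: divide_inverse inverse_mult_distrib mult_ac)
      have "- ((int n - 1) div 2) = - int ((n - 1) div 2)"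
        using assms(1) by (simp add: zdiv_int of_nat_diff)
      hence pw: "Z powi (- ((int n - 1) div 2)) = inverse (Z ^ ((n - 1) div 2))"
        by (simp only: power_int_minus power_int_of_nat)
      have set: "{0..n - 1} = {..<n}" using n1 by auto
      have "fh.ext (?L - ?R) = (\<Sum>k<n. sum_coeff k * tpoch 1 Z k * inverse (1 - Z)) -
          inverse (Z ^ ((n - 1) div 2)) * ((1 - Z ^ n) / (1 - Z)) * of_int (chi_3 n)"
        unfolding fh.ext_diff fh.ext_sum fh.ext_mult fh.ext_divide fh.ext_power fh.ext_qpoch
          fh.ext_power_int fh.ext_of_int ev_qvar qnum_def fh.ext_1 term_eq pw set
          kronecker_minus_3[OF assms] ..
      also have "\<dots> = T * inverse (1 - Z)"
      proof -
        have "(S - i * p * x) * v = S * v - i * (p * v) * x" for S i p x v :: "complex fls"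
          by (simp add: algebra_simps)
        thus ?thesis
          unfolding T_def divide_inverse sum_distrib_right [symmetric] by simp
      qed
      finally have ext: "fh.ext (?L - ?R) = T * inverse (1 - Z)" .
      have "ord_ge (if d = n then 3 else 1) T"
      proof (cases "d = n")
        case True
        thus ?thesis using ord_ge_3_if_order_eq by (simp add: T_def)
      next
        case False
        \<comment> \<open>For a proper divisor \<open>d\<close> both sides vanish at
          \<open>\<zeta>\<close>: the sum consists of \<open>m\<close> full periods, and
          \<open>1 - \<zeta> ^ n = 0\<close>.\<close>
        obtain m where m: "n = m * d" using d(2) by (metis dvd_div_mult_self)
        have "has_value (inverse (Z ^ ((n - 1) div 2)) * (1 - Z ^ n) * of_int (chi_3 n))
            (inverse (\<zeta> ^ ((n - 1) div 2)) * (1 - \<zeta> ^ n) * of_int (chi_3 n))"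
        proof (intro has_value_mult has_value_inverse has_value_power has_value_Z has_value_one_minus)
          show "has_value (of_int (chi_3 n)) (of_int (chi_3 n))"
            by (rule has_valueI[of _ "of_int (chi_3 n)"]) (auto simp: fps_to_fls_of_int)
        qed (simp add: \<zeta>_nz)
        hence "has_value (inverse (Z ^ ((n - 1) div 2)) * (1 - Z ^ n) * of_int (chi_3 n)) 0"
          using \<zeta>_power_eq_1_iff[of n] d(2) by simp
        from has_value_diff[OF has_value_sum_multiple[of m] this] have "has_value T 0"
          by (simp add: T_def m)
        from has_value_0_imp_ord_ge[OF this] show ?thesis using False by simp
      qed
      moreover have "has_value (inverse (1 - Z)) (inverse (1 - \<zeta>))"
        using has_value_one_minus[of 1] \<zeta>_power_eq_1_iff[of 1] d(3) by (intro has_value_inverse) auto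
      ultimately show ?thesis
        unfolding ab(2) [symmetric] ext by (rule ord_ge_mult_has_value)
    qed
    have lcP: "lead_coeff P = 1"
      unfolding P_def by (rule lead_coeff_modulus[OF assms(1)])
    \<comment> \<open>At a root of \<open>P\<close> the fraction is regular, so a zero of
      \<open>b\<close> there would be a common zero with \<open>a\<close>.\<close>
    have b_root: "poly (map_poly of_int b) \<zeta> \<noteq> 0" if root: "poly (map_poly of_int P) \<zeta> = 0" for \<zeta> :: complex
    proof
      assume b0: "poly (map_poly of_int b) \<zeta> = 0"
      obtain d where d: "prim_root \<zeta> d" "d dvd n" "d > 1"
        using modulus_root[OF n1 root[unfolded P_def]] by metis
      have "coprime d 6"
        using assms(2) d(2) by (rule coprime_divisors[OF _ dvd_refl, rotated])
      then interpret primitive_root \<zeta> d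
        using d by unfold_locales auto
      have "ord_ge 1 (fh.ext (Fract a b))"
        using ord[OF d] by (rule ord_ge_mono) simp
      from ord_ge_root[OF this ab(1) b0] ab(3) b0 show False by blast
    qed
    have "P dvd a"
    proof (cases "a = 0")
      case False
      have "(map_poly of_int P :: complex poly) dvd map_poly of_int a"
      proof (rule dvd_of_order_le)
        show "(map_poly of_int a :: complex poly) \<noteq> 0"
          using False of_int_poly_eq_iff[of a 0, where 'a = complex] by simp
        show "(map_poly of_int P :: complex poly) \<noteq> 0"
          using lcP of_int_poly_eq_iff[of P 0, where 'a = complex] by auto
        fix \<zeta> :: complex assume root: "poly (map_poly of_int P) \<zeta> = 0"
        obtain d where d: "prim_root \<zeta> d" "d dvd n" "d > 1"
          "Polynomial.order \<zeta> (map_poly of_int P) \<le> (if d = n then 3 else 1)"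
          using modulus_root[OF n1 root[unfolded P_def]] unfolding P_def by metis
        have "coprime d 6"
          using assms(2) d(2) by (rule coprime_divisors[OF _ dvd_refl, rotated])
        then interpret primitive_root \<zeta> d
          using d by unfold_locales auto
        show "Polynomial.order \<zeta> (map_poly of_int P) \<le> Polynomial.order \<zeta> (map_poly of_int a)"
          using ord_ge_order[OF ord[OF d(1-3)] ab(1) False b_root[OF root]] d(4) by linarith
      qed
      with lcP show ?thesis by (rule monic_dvd_of_int)
    qed simp
    moreover have "coprime P b"
      using lcP b_root by (rule coprime_monic_int_poly)
    ultimately show ?thesis
      unfolding ratfun_cong_def ratfun_cong_0_def P_def using ab by blast
  qed
qed

end
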